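(* Let $\rho$ be an admissible weight function on $[0,\infty[$ with $\sup_{k\in\mathbb{N}}\frac{\rho(k+1)}{\rho(k)}<\infty$, and let $\mathcal{T}=(T_t)_{t\ge0}$ be the translation semigroup on $C_0^\rho([0,\infty[)$. Then $\mathcal{T}$ is frequently hypercyclic on $C_0^\rho([0,\infty[)$ if and only if there exist a sequence $(M(p))_{p\in\mathbb{N}}$ of positive real numbers tending to $\infty$ and a sequence $(E_p)_{p\in\mathbb{N}}$ of subsets of $\mathbb{N}$ such that: (a) for any $p\ge1$, $\underline{\mathrm{dens}}(E_p)>0$; (b) for any distinct $p,q\ge1$, $(E_p+([0,p]\cap\mathbb{Z}))\cap(E_q+([0,q]\cap\mathbb{Z}))=\emptyset$; (c) for every $p\ge1$, $\lim_{n\to\infty,\,n\in E_p}\rho(n)=0$; (d) for any $p,q\ge1$ and any $n\in E_p$ and $m\in E_q$ with $m>n$, $$\rho(m-n)\le\frac{1}{M(p)M(q)}.$$ Moreover, the same equivalence holds with "there exist a sequence $(M(p))_{p\in\mathbb{N}}$ and a sequence $(E_p)_{p\in\mathbb{N}}$" replaced by "for any sequence $(M(p))_{p\in\mathbb{N}}$ (of positive real numbers tending to $\infty$) there exists a sequence $(E_p)_{p\in\mathbb{N}}$".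
   Context: $\mathbb{N}=\{1,2,\dots\}$. An admissible weight function on $[0,\infty[$ is a measurable function $\rho:[0,\infty[\,\to\,]0,\infty[$ for which there exist $M\ge1$ and $\omega\in\mathbb{R}$ such that $\rho(\tau)\le Me^{\omega t}\rho(\tau+t)$ for all $\tau\ge0$ and $t>0$. $C_0^\rho([0,\infty[)$ is the space of continuous $u:[0,\infty[\,\to\mathbb{R}$ with $\lim_{x\to\infty}u(x)\rho(x)=0$, with norm $\|u\|_\infty^\rho=\sup_{t\ge0}|u(t)|\rho(t)$. The translation semigroup on it is $T_tf(x)=f(x+t)$, $t\ge0$, $x\ge0$; it is a $C_0$-semigroup. The lower density of $A\subseteq\mathbb{N}$ is $\underline{\mathrm{dens}}(A)=\liminf_{N\to\infty}\#\{n\le N:n\in A\}/N$. The lower density of a measurable set $S\subseteq\mathbb{R}_+$ is $\underline{\mathrm{Dens}}(S)=\liminf_{N\to\infty}\mu(S\cap[0,N])/N$, with $\mu$ Lebesgue measure. A $C_0$-semigroup $(T_t)_{t\ge0}$ on a separable Banach space $X$ is frequently hypercyclic if there exists $x\in X$ such that $\underline{\mathrm{Dens}}(\{t\in\mathbb{R}_+:T_tx\in U\})>0$ for every non-empty open $U\subseteq X$. *)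

theory Defs
  imports "HOL-Analysis.Analysis"
begin

text \<open>Only the values of \<open>\<rho>\<close> on the half-line \<open>{0..}\<close> matter. Measurability is Lebesgue
  measurability.\<close>

definition admissible_weight :: "(real \<Rightarrow> real) \<Rightarrow> bool" where
  "admissible_weight \<rho> \<longleftrightarrow>
     \<rho> \<in> borel_measurable (lebesgue_on {0..}) \<and>
     (\<forall>\<tau>\<ge>0. \<rho> \<tau> > 0) \<and>
     (\<exists>M\<ge>1. \<exists>\<omega>. \<forall>\<tau>\<ge>0. \<forall>t>0. \<rho> \<tau> \<le> M * exp (\<omega> * t) * \<rho> (\<tau> + t))"

text \<open>A function on the half-line is represented by the total function that agrees with it on
  \<open>{0..}\<close> and is \<open>undefined\<close> elsewhere (\<^const>\<open>extensional\<close>), so that equality in HOL is equality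
  of functions on the half-line.\<close>

definition C0_space :: "(real \<Rightarrow> real) \<Rightarrow> (real \<Rightarrow> real) set" where
  "C0_space \<rho> =
     {u \<in> extensional {0..}. continuous_on {0..} u \<and> ((\<lambda>x. u x * \<rho> x) \<longlongrightarrow> 0) at_top}"

definition C0_norm :: "(real \<Rightarrow> real) \<Rightarrow> (real \<Rightarrow> real) \<Rightarrow> real" where
  "C0_norm \<rho> u = (SUP t\<in>{0..}. \<bar>u t\<bar> * \<rho> t)"

text \<open>The value \<open>0\<close> off the carrier is needed because \<^locale>\<open>Metric_space\<close> requires a globally
  nonnegative distance.\<close>

definition C0_dist :: "(real \<Rightarrow> real) \<Rightarrow> (real \<Rightarrow> real) \<Rightarrow> (real \<Rightarrow> real) \<Rightarrow> real" where
  "C0_dist \<rho> u v =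
     (if u \<in> C0_space \<rho> \<and> v \<in> C0_space \<rho> then C0_norm \<rho> (\<lambda>x. u x - v x) else 0)"

definition C0_topology :: "(real \<Rightarrow> real) \<Rightarrow> (real \<Rightarrow> real) topology" where
  "C0_topology \<rho> = Metric_space.mtopology (C0_space \<rho>) (C0_dist \<rho>)"

definition translation :: "real \<Rightarrow> (real \<Rightarrow> real) \<Rightarrow> (real \<Rightarrow> real)" where
  "translation t f = (\<lambda>x\<in>{0..}. f (x + t))"

text \<open>The lower density of a set of positive integers; the term at \<open>N = 0\<close> is irrelevant.\<close>

definition lower_dens :: "nat set \<Rightarrow> ereal" where
  "lower_dens A = liminf (\<lambda>N. ereal (real (card {n \<in> A. 1 \<le> n \<and> n \<le> N}) / real N))"

definition lower_Dens :: "real set \<Rightarrow> ereal" where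
  "lower_Dens S = liminf (\<lambda>N. ereal (measure lebesgue (S \<inter> {0..real N}) / real N))"

definition frequently_hypercyclic :: "'a topology \<Rightarrow> (real \<Rightarrow> 'a \<Rightarrow> 'a) \<Rightarrow> bool" where
  "frequently_hypercyclic X T \<longleftrightarrow>
     (\<exists>x\<in>topspace X. \<forall>U. openin X U \<and> U \<noteq> {} \<longrightarrow> lower_Dens {t. 0 \<le> t \<and> T t x \<in> U} > 0)"

text \<open>Sequences are indexed by the positive integers: the values at \<open>p = 0\<close> are ignored.
  In (b), the sum of sets is the elementwise sum.\<close>

definition positive_tending_to_infinity :: "(nat \<Rightarrow> real) \<Rightarrow> bool" where
  "positive_tending_to_infinity M \<longleftrightarrow> (\<forall>p\<ge>1. M p > 0) \<and> filterlim M at_top sequentially"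

definition fhc_sets :: "(real \<Rightarrow> real) \<Rightarrow> (nat \<Rightarrow> real) \<Rightarrow> (nat \<Rightarrow> nat set) \<Rightarrow> bool" where
  "fhc_sets \<rho> M E \<longleftrightarrow>
     (\<forall>p\<ge>1. E p \<subseteq> {1..}) \<and>
     \<comment> \<open>(a)\<close> (\<forall>p\<ge>1. lower_dens (E p) > 0) \<and>
     \<comment> \<open>(b)\<close> (\<forall>p\<ge>1. \<forall>q\<ge>1. p \<noteq> q \<longrightarrow> (E p + {0..p}) \<inter> (E q + {0..q}) = {}) \<and>
     \<comment> \<open>(c)\<close> (\<forall>p\<ge>1. ((\<lambda>n. \<rho> (real n)) \<longlongrightarrow> 0) (inf sequentially (principal (E p)))) \<and>
     \<comment> \<open>(d)\<close> (\<forall>p\<ge>1. \<forall>q\<ge>1. \<forall>n\<in>E p. \<forall>m\<in>E q. n < m \<longrightarrow>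
                \<rho> (real m - real n) \<le> 1 / (M p * M q))"

text \<open>Well-definedness: the supremum norm is finite and induces a metric, and the translation
  operators act on the space as a one-parameter semigroup.\<close>

lemma C0_bdd_above:
  assumes \<rho>: "admissible_weight \<rho>" and u: "u \<in> C0_space \<rho>"
  shows "bdd_above ((\<lambda>t. \<bar>u t\<bar> * \<rho> t) ` {0..})"
proof -
  obtain M \<omega> where M: "M \<ge> 1"
    and adm: "\<And>\<tau> t. \<tau> \<ge> 0 \<Longrightarrow> t > 0 \<Longrightarrow> \<rho> \<tau> \<le> M * exp (\<omega> * t) * \<rho> (\<tau> + t)"
    and pos: "\<And>t. t \<ge> 0 \<Longrightarrow> \<rho> t > 0"
    using \<rho> unfolding admissible_weight_def by blast
  have "((\<lambda>x. u x * \<rho> x) \<longlongrightarrow> 0) at_top" using u by (simp add: C0_space_def)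
  then have "eventually (\<lambda>x. \<bar>u x * \<rho> x\<bar> < 1) at_top"
    by (intro order_tendstoD(2)[OF tendsto_rabs_zero]) auto
  then obtain L0 where L0: "\<And>x. x \<ge> L0 \<Longrightarrow> \<bar>u x * \<rho> x\<bar> < 1"
    by (auto simp: eventually_at_top_linorder)
  define L where "L = max L0 0 + 1"
  have L: "L > 0" "L \<ge> L0" by (auto simp: L_def)
  have "compact (u ` {0..L})"
    using u by (intro compact_continuous_image)
      (auto simp: C0_space_def intro: continuous_on_subset)
  then obtain B where B: "\<And>x. x \<in> {0..L} \<Longrightarrow> \<bar>u x\<bar> \<le> B"
    by (force simp: bounded_iff dest!: compact_imp_bounded)
  have B0: "B \<ge> 0" using B[of 0] L by force
  have RL: "\<rho> L > 0" using pos L by simp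
  define K where "K = M * exp (\<bar>\<omega>\<bar> * L) * \<rho> L"
  have \<rho>K: "\<rho> x \<le> K" if x: "0 \<le> x" "x < L" for x
  proof -
    have "\<rho> x \<le> M * exp (\<omega> * (L - x)) * \<rho> L" using adm[of x "L - x"] x by simp
    also have "\<omega> * (L - x) \<le> \<bar>\<omega>\<bar> * L"
      using x by (intro order_trans[OF mult_right_mono[OF abs_ge_self] mult_left_mono]) auto
    then have "M * exp (\<omega> * (L - x)) * \<rho> L \<le> K"
      unfolding K_def using M RL by (intro mult_right_mono mult_left_mono) auto
    finally show ?thesis .
  qed
  have "\<bar>u x\<bar> * \<rho> x \<le> max (B * K) 1" if x: "0 \<le> x" for x
  proof (cases "x < L")
    case True
    have "\<bar>u x\<bar> * \<rho> x \<le> B * K"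
      using B[of x] \<rho>K[of x] True x B0 pos[of x] by (intro mult_mono) auto
    then show ?thesis by simp
  next
    case False
    then show ?thesis using L0[of x] L pos[of x] x by (simp add: abs_mult)
  qed
  then show ?thesis by (intro bdd_aboveI[where M = "max (B * K) 1"]) auto
qed

lemma Metric_space_C0:
  assumes \<rho>: "admissible_weight \<rho>"
  shows "Metric_space (C0_space \<rho>) (C0_dist \<rho>)"
proof -
  let ?C = "C0_space \<rho>"
  have pos: "\<And>t. t \<ge> 0 \<Longrightarrow> \<rho> t > 0" using \<rho> by (simp add: admissible_weight_def)
  define ext where "ext u v = (\<lambda>x\<in>{0..}. u x - v x :: real)" for u v :: "real \<Rightarrow> real"
  have ext: "ext u v \<in> ?C" if "u \<in> ?C" "v \<in> ?C" for u v
  proof -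
    have "((\<lambda>x. u x * \<rho> x - v x * \<rho> x) \<longlongrightarrow> 0) at_top"
      using that tendsto_diff[of "\<lambda>x. u x * \<rho> x" 0 at_top "\<lambda>x. v x * \<rho> x" 0]
      by (simp add: C0_space_def)
    moreover have "eventually (\<lambda>x. u x * \<rho> x - v x * \<rho> x = ext u v x * \<rho> x) at_top"
      using eventually_ge_at_top[of 0] by eventually_elim (simp add: ext_def algebra_simps)
    ultimately have "((\<lambda>x. ext u v x * \<rho> x) \<longlongrightarrow> 0) at_top"
      by (rule Lim_transform_eventually)
    moreover have "continuous_on {0..} (\<lambda>x. u x - v x)"
      using that by (auto simp: C0_space_def intro: continuous_on_diff)
    then have "continuous_on {0..} (ext u v)"
      by (subst continuous_on_cong[OF refl, of _ _ "\<lambda>x. u x - v x"]) (auto simp: ext_def)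
    ultimately show ?thesis by (simp add: C0_space_def ext_def)
  qed
  have bdd: "bdd_above ((\<lambda>t. \<bar>u t - v t\<bar> * \<rho> t) ` {0..})" if "u \<in> ?C" "v \<in> ?C" for u v
  proof -
    have "(\<lambda>t. \<bar>u t - v t\<bar> * \<rho> t) ` {0..} = (\<lambda>t. \<bar>ext u v t\<bar> * \<rho> t) ` {0..}"
      by (intro image_cong) (auto simp: ext_def)
    then show ?thesis using C0_bdd_above[OF \<rho> ext[OF that]] by simp
  qed
  have upper: "\<bar>u t - v t\<bar> * \<rho> t \<le> C0_dist \<rho> u v" if "u \<in> ?C" "v \<in> ?C" "t \<ge> 0" for u v t
    using that cSUP_upper[OF _ bdd[OF that(1,2)], of t] by (simp add: C0_dist_def C0_norm_def)
  show ?thesis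
  proof
    fix u v show "0 \<le> C0_dist \<rho> u v"
    proof (cases "u \<in> ?C \<and> v \<in> ?C")
      case True
      have "0 \<le> \<bar>u 0 - v 0\<bar> * \<rho> 0" using pos[of 0] by simp
      also have "\<dots> \<le> C0_dist \<rho> u v" using True by (intro upper) auto
      finally show ?thesis .
    qed (auto simp: C0_dist_def)
  next
    fix u v show "C0_dist \<rho> u v = C0_dist \<rho> v u"
      by (simp add: C0_dist_def C0_norm_def abs_minus_commute)
  next
    fix u v assume uv: "u \<in> ?C" "v \<in> ?C"
    show "C0_dist \<rho> u v = 0 \<longleftrightarrow> u = v"
    proof
      assume 0: "C0_dist \<rho> u v = 0"
      have "u t = v t" if "t \<ge> 0" for t
        using upper[OF uv that] pos[OF that] 0 by (simp add: mult_le_0_iff)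
      then show "u = v" using uv by (intro extensionalityI[of u "{0..}"]) (auto simp: C0_space_def)
    qed (simp add: C0_dist_def C0_norm_def)
  next
    fix u v w assume uvw: "u \<in> ?C" "v \<in> ?C" "w \<in> ?C"
    have "\<bar>u t - w t\<bar> * \<rho> t \<le> C0_dist \<rho> u v + C0_dist \<rho> v w" if t: "t \<ge> 0" for t
    proof -
      have "\<bar>u t - w t\<bar> * \<rho> t \<le> (\<bar>u t - v t\<bar> + \<bar>v t - w t\<bar>) * \<rho> t"
        using pos[OF t] by (intro mult_right_mono) auto
      also have "\<dots> \<le> C0_dist \<rho> u v + C0_dist \<rho> v w"
        using upper[OF uvw(1,2) t] upper[OF uvw(2,3) t] by (simp add: distrib_right)
      finally show ?thesis .
    qed
    then have "C0_norm \<rho> (\<lambda>x. u x - w x) \<le> C0_dist \<rho> u v + C0_dist \<rho> v w"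
      unfolding C0_norm_def by (intro cSUP_least) auto
    then show "C0_dist \<rho> u w \<le> C0_dist \<rho> u v + C0_dist \<rho> v w"
      using uvw by (simp add: C0_dist_def)
  qed
qed

lemma topspace_C0_topology:
  "admissible_weight \<rho> \<Longrightarrow> topspace (C0_topology \<rho>) = C0_space \<rho>"
  unfolding C0_topology_def by (rule Metric_space.topspace_mtopology[OF Metric_space_C0])

lemma translation_in_C0_space:
  assumes \<rho>: "admissible_weight \<rho>" and t: "t \<ge> 0" and f: "f \<in> C0_space \<rho>"
  shows "translation t f \<in> C0_space \<rho>"
proof -
  obtain M \<omega> where M: "M \<ge> 1"
    and adm: "\<And>\<tau> t. \<tau> \<ge> 0 \<Longrightarrow> t > 0 \<Longrightarrow> \<rho> \<tau> \<le> M * exp (\<omega> * t) * \<rho> (\<tau> + t)"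
    and pos: "\<And>t. t \<ge> 0 \<Longrightarrow> \<rho> t > 0"
    using \<rho> unfolding admissible_weight_def by blast
  have bound: "\<rho> x \<le> M * exp (\<omega> * t) * \<rho> (x + t)" if "x \<ge> 0" for x
    using adm[of x t] that t pos[of x] M mult_right_mono[of 1 M "\<rho> x"] by (cases "t = 0") auto
  have "continuous_on {0..} (\<lambda>x. f (x + t))"
  proof (rule continuous_on_compose2[of "{0..}" f "{0..}" "\<lambda>x. x + t"])
    show "continuous_on {0..} f" using f by (simp add: C0_space_def)
    show "continuous_on {0..} (\<lambda>x. x + t)" by (intro continuous_intros)
    show "(\<lambda>x. x + t) ` {0..} \<subseteq> {0..}" using t by auto
  qed
  then have 1: "continuous_on {0..} (translation t f)"
    by (subst continuous_on_cong[OF refl, of _ _ "\<lambda>x. f (x + t)"]) (auto simp: translation_def)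
  have "((\<lambda>x. f x * \<rho> x) \<longlongrightarrow> 0) at_top" using f by (simp add: C0_space_def)
  moreover have "filterlim (\<lambda>x. x + t) at_top at_top"
    by (simp add: add.commute[of _ t] filterlim_tendsto_add_at_top[OF tendsto_const filterlim_ident])
  ultimately have "((\<lambda>x. f (x + t) * \<rho> (x + t)) \<longlongrightarrow> 0) at_top"
    by (rule filterlim_compose)
  then have lim: "((\<lambda>x. M * exp (\<omega> * t) * \<bar>f (x + t) * \<rho> (x + t)\<bar>) \<longlongrightarrow> 0) at_top"
    by (intro tendsto_mult_right_zero tendsto_rabs_zero)
  have "eventually (\<lambda>x. norm (translation t f x * \<rho> x)
          \<le> M * exp (\<omega> * t) * \<bar>f (x + t) * \<rho> (x + t)\<bar>) at_top"
    using eventually_ge_at_top[of 0]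
  proof eventually_elim
    case (elim x)
    have "\<bar>f (x + t)\<bar> * \<rho> x \<le> \<bar>f (x + t)\<bar> * (M * exp (\<omega> * t) * \<rho> (x + t))"
      using bound[OF elim] by (intro mult_left_mono) auto
    then show ?case using elim t pos[of x] pos[of "x + t"]
      by (simp add: translation_def abs_mult algebra_simps)
  qed
  then have "((\<lambda>x. translation t f x * \<rho> x) \<longlongrightarrow> 0) at_top"
    using lim by (rule Lim_null_comparison)
  then show ?thesis using 1 by (simp add: C0_space_def translation_def)
qed

lemma translation_0: "f \<in> C0_space \<rho> \<Longrightarrow> translation 0 f = f"
  by (simp add: translation_def C0_space_def extensional_restrict)

lemma translation_add:
  "s \<ge> 0 \<Longrightarrow> t \<ge> 0 \<Longrightarrow> translation (s + t) f = translation s (translation t f)"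
  by (auto simp: translation_def fun_eq_iff add.assoc)

end

theory Submission
  imports Defs
begin

text \<open>If \<open>f\<close> is frequently hypercyclic, let \<open>E\<^sub>p\<close> consist of well-separated times at which the orbit of
  \<open>f\<close> is very close to a plateau of height \<open>A\<^sub>p \<ge> M p + 2\<close> and length about \<open>p\<close>. Since the heights
  are distinct, blocks starting in different \<open>E\<^sub>p\<close> cannot overlap; and for \<open>n \<in> E\<^sub>p\<close>, \<open>m \<in> E\<^sub>q\<close>,
  \<open>n < m\<close>, the value \<open>f m \<approx> A\<^sub>q\<close> lies where the translate by \<open>n\<close> must be small, which forces
  \<open>\<rho> (m - n)\<close> to be small.
  Conversely, given the sets, choose compactly supported functions \<open>h\<^sub>i\<close> dense in the space and
  sparse indices \<open>p\<^sub>i\<close> such that \<open>M (p\<^sub>i)\<close> is huge compared with the size and support of \<open>h\<^sub>i\<close>. The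
  sum of the translates of \<open>h\<^sub>i\<close> to \<open>n + 1\<close>, \<open>n \<in> E\<^bsub>p\<^sub>i\<^esub>\<close>, is then a frequently hypercyclic vector.\<close>

section \<open>Lower densities\<close>

text \<open>Replaces positivity of a lower density by an eventual linear lower bound, in which
  extended reals no longer occur. Any real \<open>c\<close> strictly between 0 and the liminf serves
  as slope.\<close>

lemma liminf_ratio_pos_iff:
  fixes a :: "nat \<Rightarrow> real"
  shows "liminf (\<lambda>N. ereal (a N / real N)) > 0 \<longleftrightarrow>
    (\<exists>c>0. \<forall>\<^sub>F N in sequentially. c * real N \<le> a N)" (is "?L \<longleftrightarrow> ?R")
proof
  assume ?L
  then obtain c where c: "0 < ereal c" "ereal c < liminf (\<lambda>N. ereal (a N / real N))"
    using ereal_dense2 by blast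
  from less_LiminfD[OF c(2)] eventually_gt_at_top[of 0]
  have "\<forall>\<^sub>F N in sequentially. c * real N \<le> a N"
    by eventually_elim (simp add: field_simps)
  then show ?R using c(1) by auto
next
  assume ?R
  then obtain c where c: "c > 0" "\<forall>\<^sub>F N in sequentially. c * real N \<le> a N" by blast
  from c(2) eventually_gt_at_top[of 0]
  have "\<forall>\<^sub>F N in sequentially. ereal c \<le> ereal (a N / real N)"
    by eventually_elim (simp add: field_simps)
  then have "ereal c \<le> liminf (\<lambda>N. ereal (a N / real N))" by (rule Liminf_bounded)
  then show ?L using c(1) by (meson ereal_less(2) less_le_trans)
qed

text \<open>All density comparisons below reduce to this one. The additive constant \<open>l\<close>
  is absorbed once \<open>N \<ge> 2 * l / c\<close>, at the price of half the slope.\<close>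

lemma liminf_ratio_pos_transfer:
  fixes a b :: "nat \<Rightarrow> real"
  assumes a: "liminf (\<lambda>N. ereal (a N / real N)) > 0"
    and le: "\<And>N. a N \<le> k * b N + l" and k: "k > 0"
  shows "liminf (\<lambda>N. ereal (b N / real N)) > 0"
proof -
  obtain c where c: "c > 0" "\<forall>\<^sub>F N in sequentially. c * real N \<le> a N"
    using a liminf_ratio_pos_iff by blast
  have "\<forall>\<^sub>F N in sequentially. 2 * l / c \<le> real N"
    by (meson eventually_sequentiallyI nat_ceiling_le_eq)
  with c(2) have "\<forall>\<^sub>F N in sequentially. c / (2 * k) * real N \<le> b N"
  proof eventually_elim
    case (elim N)
    then have "c * real N \<le> 2 * (k * b N)" using le[of N] c(1) by (simp add: field_simps)
    then show ?case using k by (simp add: field_simps)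
  qed
  moreover have "c / (2 * k) > 0" using c(1) k by simp
  ultimately show ?thesis using liminf_ratio_pos_iff by blast
qed

text \<open>Greedy selection from left to right. The quantifier is bounded by \<open>{..<n}\<close>
  so that its congruence rule provides \<open>b < n\<close> for termination.\<close>

fun greedy :: "nat set \<Rightarrow> nat \<Rightarrow> nat \<Rightarrow> bool" where
  "greedy A k n \<longleftrightarrow> n \<in> A \<and> (\<forall>b\<in>{..<n}. greedy A k b \<longrightarrow> b + k \<le> n)"

declare greedy.simps [simp del]

text \<open>Every element of \<open>A\<close> that is not kept comes less than \<open>k\<close>
  after a kept one, so the blocks \<open>{b..<b + k}\<close> with kept \<open>b\<close> cover
  \<open>A\<close>, and the density drops at most by the factor \<open>k\<close>. Since
  \<open>A\<close> avoids 0, these \<open>b\<close> are all seen by the count that starts at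
  1.\<close>

lemma separated_subset:
  assumes A: "A \<subseteq> {1..}" and dens: "lower_dens A > 0" and k: "k \<ge> 1"
  obtains B where "B \<subseteq> A" "lower_dens B > 0" "\<And>m n. m \<in> B \<Longrightarrow> n \<in> B \<Longrightarrow> m < n \<Longrightarrow> m + k \<le> n"
proof
  let ?B = "{n. greedy A k n}"
  have in_A: "n \<in> A" if "greedy A k n" for n
    using iffD1[OF greedy.simps that] by (rule conjunct1)
  have sep: "m + k \<le> n" if "greedy A k m" "greedy A k n" "m < n" for m n
    using conjunct2[OF iffD1[OF greedy.simps that(2)]] that(1,3) by (simp add: lessThan_iff)
  have cover: "\<exists>b<n. greedy A k b \<and> n < b + k" if "n \<in> A" "\<not> greedy A k n" for n
    using iffD2[OF greedy.simps, of n A k] that by (metis lessThan_iff not_le)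
  show "?B \<subseteq> A" using in_A by blast
  show "m + k \<le> n" if "m \<in> ?B" "n \<in> ?B" "m < n" for m n
    using that sep by simp
  have "card {n \<in> A. 1 \<le> n \<and> n \<le> N} \<le> k * card {n \<in> ?B. 1 \<le> n \<and> n \<le> N}" for N
  proof -
    let ?C = "{n \<in> ?B. 1 \<le> n \<and> n \<le> N}"
    have "{n \<in> A. 1 \<le> n \<and> n \<le> N} \<subseteq> (\<Union>b\<in>?C. {b..<b + k})"
    proof
      fix n assume n: "n \<in> {n \<in> A. 1 \<le> n \<and> n \<le> N}"
      show "n \<in> (\<Union>b\<in>?C. {b..<b + k})"
      proof (cases "greedy A k n")
        case True
        then show ?thesis using n k by auto
      next
        case False
        then obtain b where b: "b < n" "greedy A k b" "n < b + k"
          using cover[of n] n False by auto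
        moreover have "b \<in> A" using b(2) in_A by simp
        then have "1 \<le> b" using A by auto
        ultimately show ?thesis using n by auto
      qed
    qed
    then have "card {n \<in> A. 1 \<le> n \<and> n \<le> N} \<le> card (\<Union>b\<in>?C. {b..<b + k})"
      by (intro card_mono) auto
    also have "\<dots> \<le> (\<Sum>b\<in>?C. card {b..<b + k})" by (intro card_UN_le) auto
    also have "\<dots> = k * card ?C" by simp
    finally show ?thesis .
  qed
  then have "real (card {n \<in> A. 1 \<le> n \<and> n \<le> N})
      \<le> real k * real (card {n \<in> ?B. 1 \<le> n \<and> n \<le> N}) + 0" for N
    unfolding add_0_right of_nat_mult[symmetric] of_nat_le_iff .
  from liminf_ratio_pos_transfer[OF dens[unfolded lower_dens_def] this] k
  show "lower_dens ?B > 0" by (simp add: lower_dens_def)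
qed

lemma lower_dens_cofinite_subset:
  assumes dens: "lower_dens A > 0" and fin: "finite (A - B)"
  shows "lower_dens B > 0"
proof -
  have "real (card {n \<in> A. 1 \<le> n \<and> n \<le> N})
      \<le> 1 * real (card {n \<in> B. 1 \<le> n \<and> n \<le> N}) + real (card (A - B))" for N
  proof -
    have "card {n \<in> A. 1 \<le> n \<and> n \<le> N} \<le> card ({n \<in> B. 1 \<le> n \<and> n \<le> N} \<union> (A - B))"
      using fin by (intro card_mono) auto
    also have "\<dots> \<le> card {n \<in> B. 1 \<le> n \<and> n \<le> N} + card (A - B)" by (rule card_Un_le)
    finally show ?thesis by (simp flip: of_nat_add)
  qed
  from liminf_ratio_pos_transfer[OF dens[unfolded lower_dens_def] this]
  show ?thesis by (simp add: lower_dens_def)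
qed

text \<open>The intervals \<open>[n - 1, n]\<close> over the selected \<open>n \<le> N\<close> cover
  \<open>S \<inter> {0..N}\<close> up to the point 0, so its measure is at most their
  number.\<close>

lemma lower_dens_ceiling_pos:
  assumes "lower_Dens S > 0"
  shows "lower_dens {n. 1 \<le> n \<and> (\<exists>t\<in>S. real n - 1 < t \<and> t \<le> real n)} > 0" (is "lower_dens ?A > 0")
proof -
  have "measure lebesgue (S \<inter> {0..real N}) \<le> 1 * real (card {n \<in> ?A. 1 \<le> n \<and> n \<le> N}) + 0" for N
  proof (cases "S \<inter> {0..real N} \<in> sets lebesgue")
    case True
    let ?C = "{n \<in> ?A. 1 \<le> n \<and> n \<le> N}"
    let ?I = "\<lambda>n::nat. {real n - 1..real n}"
    have sub: "S \<inter> {0..real N} \<subseteq> {0..0} \<union> (\<Union>n\<in>?C. ?I n)"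
    proof
      fix t assume t: "t \<in> S \<inter> {0..real N}"
      show "t \<in> {0..0} \<union> (\<Union>n\<in>?C. ?I n)"
      proof (cases "t = 0")
        case False
        define n where "n = nat \<lceil>t\<rceil>"
        have "t > 0" using t False by auto
        then have n: "real n = of_int \<lceil>t\<rceil>" unfolding n_def by simp
        have "real n - 1 < t" "t \<le> real n" unfolding n by linarith+
        moreover from this \<open>t > 0\<close> have "1 \<le> n" by linarith
        moreover have "n \<le> N" using t unfolding n_def by (simp add: ceiling_le_iff)
        ultimately show ?thesis using t by auto
      qed auto
    qed
    have fin: "finite ?C" by simp
    have "measure lebesgue (S \<inter> {0..real N}) \<le> measure lebesgue ({0..0} \<union> (\<Union>n\<in>?C. ?I n))"
      using sub True fin
      by (intro measure_mono_fmeasurable fmeasurable.Un fmeasurable.finite_UN)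
        (auto simp del: atLeastAtMost_singleton)
    also have "\<dots> \<le> measure lebesgue {0..0::real} + measure lebesgue (\<Union>n\<in>?C. ?I n)"
      using fin by (intro measure_Un_le) auto
    also have "measure lebesgue (\<Union>n\<in>?C. ?I n) \<le> (\<Sum>n\<in>?C. measure lebesgue (?I n))"
      using fin by (intro measure_UNION_le) auto
    also have "(\<Sum>n\<in>?C. measure lebesgue (?I n)) = real (card ?C)" by simp
    finally show ?thesis by simp
  next
    case False
    \<comment> \<open>Sets that are not measurable have \<open>measure\<close> 0 by
      convention.\<close>
    then show ?thesis by (simp add: measure_notin_sets)
  qed
  from liminf_ratio_pos_transfer[OF assms[unfolded lower_Dens_def] this]
  show ?thesis by (simp add: lower_dens_def)
qed

text \<open>The intervals \<open>[n + 1, n + 1 + \<delta>]\<close> are disjoint because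
  \<open>\<delta> < 1\<close>, and each contributes \<open>\<delta>\<close> to the measure of
  \<open>S\<close>. Those with \<open>n + 2 \<le> N\<close> end before \<open>N\<close>; the indices
  \<open>N - 1\<close> and \<open>N\<close> account for the additive 2.\<close>

lemma lower_Dens_pos_intervals:
  assumes dens: "lower_dens F > 0" and \<delta>: "0 < \<delta>" "\<delta> < 1" and S: "S \<in> sets lebesgue"
    and sub: "\<And>n s. n \<in> F \<Longrightarrow> 0 \<le> s \<Longrightarrow> s \<le> \<delta> \<Longrightarrow> real n + 1 + s \<in> S"
  shows "lower_Dens S > 0"
proof -
  have "real (card {n \<in> F. 1 \<le> n \<and> n \<le> N})
      \<le> (1 / \<delta>) * measure lebesgue (S \<inter> {0..real N}) + 2" for N
  proof -
    let ?C = "{n \<in> F. 1 \<le> n \<and> n + 2 \<le> N}"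
    let ?I = "\<lambda>n::nat. {real n + 1..real n + 1 + \<delta>}"
    have "card {n \<in> F. 1 \<le> n \<and> n \<le> N} \<le> card (?C \<union> {N - 1, N})"
      by (intro card_mono finite_UnI finite_subset[of ?C "{..N}"]) auto
    also have "\<dots> \<le> card ?C + card {N - 1, N}" by (rule card_Un_le)
    also have "card {N - 1, N} \<le> 2" by (simp add: card_insert_if)
    finally have 1: "real (card {n \<in> F. 1 \<le> n \<and> n \<le> N}) \<le> real (card ?C) + 2" by simp
    have fin: "finite ?C" by (rule finite_subset[of _ "{..N}"]) auto
    have disj: "disjoint_family_on ?I ?C"
      unfolding disjoint_family_on_def
    proof (intro ballI impI)
      fix m n :: nat assume "m \<noteq> n"
      then have "real m + 1 \<le> real n \<or> real n + 1 \<le> real m" by linarith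
      then show "?I m \<inter> ?I n = {}" using \<delta> by auto
    qed
    have "\<delta> * real (card ?C) = (\<Sum>n\<in>?C. measure lebesgue (?I n))" using \<delta> by simp
    also have "\<dots> = measure lebesgue (\<Union>n\<in>?C. ?I n)"
      using disj fin by (intro measure_finite_Union[symmetric]) (auto simp: emeasure_lborel_Icc_eq)
    also have "\<dots> \<le> measure lebesgue (S \<inter> {0..real N})"
    proof (rule measure_mono_fmeasurable)
      show "(\<Union>n\<in>?C. ?I n) \<subseteq> S \<inter> {0..real N}"
      proof clarify
        fix n x assume n: "n \<in> F" "1 \<le> n" "n + 2 \<le> N" "x \<in> ?I n"
        then have "x \<in> S" using sub[of n "x - (real n + 1)"] by simp
        then show "x \<in> S \<inter> {0..real N}" using n \<delta> by auto
      qed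
      show "S \<inter> {0..real N} \<in> fmeasurable lebesgue"
        using S fmeasurable_Int_fmeasurable[of "{0..real N}" lebesgue S] by (simp add: Int_commute)
    qed auto
    finally have "real (card ?C) \<le> (1 / \<delta>) * measure lebesgue (S \<inter> {0..real N})"
      using \<delta> by (simp add: field_simps)
    then show ?thesis using 1 by linarith
  qed
  from liminf_ratio_pos_transfer[OF dens[unfolded lower_dens_def] this] \<delta>
  show ?thesis by (simp add: lower_Dens_def)
qed

section \<open>Weights varying by bounded factors\<close>

text \<open>The growth hypothesis on the integers and admissibility together say that \<open>\<rho>\<close> changes by at
  most a factor \<open>D\<close> under unit steps in either direction.\<close>

locale tempered_weight =
  fixes \<rho> :: "real \<Rightarrow> real" and D :: real
  assumes admissible: "admissible_weight \<rho>"
    and D_ge_1: "D \<ge> 1"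
    and weight_le: "\<And>x y k. 0 \<le> x \<Longrightarrow> 0 \<le> y \<Longrightarrow> \<bar>x - y\<bar> \<le> real k \<Longrightarrow> \<rho> x \<le> D ^ k * \<rho> y"

text \<open>Admissibility bounds \<open>\<rho> x\<close> by values to the right of \<open>x\<close>;
  in the other direction only integer steps are controlled. For \<open>y < x \<le> y + 1\<close> and
  \<open>k\<close> the floor of \<open>y\<close>, the chain \<open>x\<close>, \<open>k + 2\<close>,
  \<open>k + 1\<close>, \<open>k\<close>, \<open>y\<close> costs the factors \<open>C\<close>,
  \<open>K\<close>, \<open>K\<close>, \<open>C\<close>.\<close>

lemma tempered_weight_exists:
  assumes adm: "admissible_weight \<rho>"
    and bdd: "bdd_above ((\<lambda>k::nat. \<rho> (real k + 1) / \<rho> (real k)) ` {1..})"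
  obtains D where "tempered_weight \<rho> D"
proof -
  obtain M \<omega> where M: "M \<ge> 1"
    and grow: "\<And>\<tau> t. \<tau> \<ge> 0 \<Longrightarrow> t > 0 \<Longrightarrow> \<rho> \<tau> \<le> M * exp (\<omega> * t) * \<rho> (\<tau> + t)"
    and pos: "\<And>t. t \<ge> 0 \<Longrightarrow> \<rho> t > 0"
    using adm unfolding admissible_weight_def by blast
  obtain K0 where K0: "\<And>k::nat. k \<ge> 1 \<Longrightarrow> \<rho> (real k + 1) / \<rho> (real k) \<le> K0"
    using bdd unfolding bdd_above_def by auto
  \<comment> \<open>The growth hypothesis starts at \<open>k = 1\<close>; the ratio at 0 is added
    here.\<close>
  define K where "K = max 1 (max K0 (\<rho> 1 / \<rho> 0))"
  have K: "K \<ge> 1" by (simp add: K_def)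
  have step: "\<rho> (real k + 1) \<le> K * \<rho> (real k)" for k
  proof -
    have "\<rho> (real k + 1) / \<rho> (real k) \<le> K"
      using K0[of k] by (cases "k = 0") (auto simp: K_def le_max_iff_disj)
    then show ?thesis using pos[of "real k"] by (simp add: field_simps)
  qed
  define C where "C = M * exp (2 * \<bar>\<omega>\<bar>)"
  have C: "C \<ge> 1" unfolding C_def using M mult_mono[of 1 M 1 "exp (2 * \<bar>\<omega>\<bar>)"] by simp
  have forward: "\<rho> x \<le> C * \<rho> y" if "0 \<le> x" "x \<le> y" "y \<le> x + 2" for x y
  proof (cases "x = y")
    case True
    then show ?thesis using C pos[of y] that by simp
  next
    case False
    have "\<omega> * (y - x) \<le> \<bar>\<omega>\<bar> * 2" using that by (intro mult_mono) auto
    then have "M * exp (\<omega> * (y - x)) * \<rho> y \<le> C * \<rho> y"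
      unfolding C_def using M pos[of y] that by (intro mult_right_mono mult_left_mono) auto
    then show ?thesis using grow[of x "y - x"] that False by simp
  qed
  define D where "D = C * K * K * C"
  have CD: "C \<le> D"
    using C K mult_mono[of C "C * K * K" 1 C] mult_mono[of C "C * K" 1 K] mult_mono[of C C 1 K]
    by (simp add: D_def)
  have unit: "\<rho> x \<le> D * \<rho> y" if "0 \<le> x" "0 \<le> y" "\<bar>x - y\<bar> \<le> 1" for x y
  proof (cases "x \<le> y")
    case True
    then have "\<rho> x \<le> C * \<rho> y" using that by (intro forward) auto
    also have "\<dots> \<le> D * \<rho> y" using CD pos[of y] that by (intro mult_right_mono) auto
    finally show ?thesis .
  next
    case False
    define k where "k = nat \<lfloor>y\<rfloor>"
    have rk: "real k = of_int \<lfloor>y\<rfloor>" using that by (simp add: k_def)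
    have k: "real k \<le> y" "y < real k + 1" unfolding rk by linarith+
    have step2: "\<rho> (real k + 1 + 1) \<le> K * \<rho> (real k + 1)" using step[of "k + 1"] by (simp add: ac_simps)
    have "\<rho> x \<le> C * \<rho> (real k + 1 + 1)" using k that False by (intro forward) auto
    also have "\<dots> \<le> C * (K * (K * \<rho> (real k)))"
      using order_trans[OF step2 mult_left_mono[OF step[of k]]] C K by (intro mult_left_mono) auto
    also have "\<dots> \<le> C * (K * (K * (C * \<rho> y)))"
      using k C K by (intro mult_left_mono forward) auto
    finally show ?thesis by (simp add: D_def mult_ac)
  qed
  have "\<rho> x \<le> D ^ k * \<rho> y" if "0 \<le> x" "0 \<le> y" "\<bar>x - y\<bar> \<le> real k" for x y k
    using that
  proof (induction k arbitrary: y)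
    case (Suc k)
    \<comment> \<open>The point one unit from \<open>y\<close> towards \<open>x\<close>, or
      \<open>x\<close> itself when it is that close.\<close>
    define z where "z = (if \<bar>x - y\<bar> \<le> 1 then x else if x < y then y - 1 else y + 1)"
    have "0 \<le> z" "\<bar>x - z\<bar> \<le> real k" "\<bar>z - y\<bar> \<le> 1"
      using Suc.prems by (auto simp: z_def)
    then have "\<rho> x \<le> D ^ k * \<rho> z" "\<rho> z \<le> D * \<rho> y" using Suc unit by auto
    then have "\<rho> x \<le> D ^ k * (D * \<rho> y)"
      using C CD by (meson mult_left_mono order_trans zero_le_power zero_le_one)
    then show ?case by (simp add: mult_ac)
  qed simp
  then have "tempered_weight \<rho> D" using adm C CD by unfold_locales auto
  then show ?thesis by (rule that)
qed

section \<open>Estimates in the weighted supremum metric\<close>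

lemma C0_dist_le:
  assumes "u \<in> C0_space \<rho>" "v \<in> C0_space \<rho>" "\<And>x. 0 \<le> x \<Longrightarrow> \<bar>u x - v x\<bar> * \<rho> x \<le> e"
  shows "C0_dist \<rho> u v \<le> e"
  using assms unfolding C0_dist_def C0_norm_def by (auto intro!: cSUP_least)

text \<open>A supremum dominates its terms only if it is taken over a bounded set. The pointwise
  difference need not be \<open>extensional\<close>, so boundedness is derived from \<open>u\<close>
  and \<open>v\<close> separately.\<close>

lemma le_C0_dist:
  assumes \<rho>: "admissible_weight \<rho>"
    and u: "u \<in> C0_space \<rho>" and v: "v \<in> C0_space \<rho>" and x: "0 \<le> x"
  shows "\<bar>u x - v x\<bar> * \<rho> x \<le> C0_dist \<rho> u v"
proof -
  obtain A B where A: "\<And>t. t \<ge> 0 \<Longrightarrow> \<bar>u t\<bar> * \<rho> t \<le> A" and B: "\<And>t. t \<ge> 0 \<Longrightarrow> \<bar>v t\<bar> * \<rho> t \<le> B"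
    using C0_bdd_above[OF \<rho> u] C0_bdd_above[OF \<rho> v] unfolding bdd_above_def by auto
  have "\<bar>u t - v t\<bar> * \<rho> t \<le> A + B" if "t \<ge> 0" for t
  proof -
    have "\<rho> t > 0" using \<rho> that by (simp add: admissible_weight_def)
    then have "\<bar>u t - v t\<bar> * \<rho> t \<le> (\<bar>u t\<bar> + \<bar>v t\<bar>) * \<rho> t" by (intro mult_right_mono) auto
    then show ?thesis using A[OF that] B[OF that] by (simp add: distrib_right)
  qed
  then have "bdd_above ((\<lambda>t. \<bar>u t - v t\<bar> * \<rho> t) ` {0..})" by (intro bdd_aboveI2) auto
  then show ?thesis
    using u v x by (auto simp: C0_dist_def C0_norm_def intro!: cSUP_upper2[of _ _ x])
qed

lemma C0_space_eventually_small:
  assumes "u \<in> C0_space \<rho>" "e > 0" "\<And>x. 0 \<le> x \<Longrightarrow> \<rho> x > 0"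
  obtains R :: nat where "\<And>x. real R \<le> x \<Longrightarrow> \<bar>u x\<bar> * \<rho> x < e"
proof -
  have "((\<lambda>x. u x * \<rho> x) \<longlongrightarrow> 0) at_top" using assms(1) by (simp add: C0_space_def)
  then have "eventually (\<lambda>x. \<bar>u x * \<rho> x\<bar> < e) at_top"
    using assms(2) by (intro order_tendstoD(2)[OF tendsto_rabs_zero]) auto
  then obtain L where L: "\<And>x. x \<ge> L \<Longrightarrow> \<bar>u x * \<rho> x\<bar> < e" by (auto simp: eventually_at_top_linorder)
  have "\<bar>u x\<bar> * \<rho> x < e" if "real (nat \<lceil>L\<rceil>) \<le> x" for x
  proof -
    have "L \<le> x" "0 \<le> x" using that real_nat_ceiling_ge[of L] by linarith+
    then show ?thesis using L[of x] assms(3)[of x] by (simp add: abs_mult)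
  qed
  then show ?thesis by (rule that)
qed

context tempered_weight
begin

lemma weight_pos: "0 \<le> x \<Longrightarrow> \<rho> x > 0"
  using admissible by (simp add: admissible_weight_def)

lemma D_power_pos: "D ^ k > 0"
  using D_ge_1 by simp

lemma weight_le_0: "0 \<le> x \<Longrightarrow> x \<le> real k \<Longrightarrow> \<rho> x \<le> D ^ k * \<rho> 0"
  using weight_le[of x 0 k] by simp

lemma weight_ge_0: "0 \<le> x \<Longrightarrow> x \<le> real k \<Longrightarrow> \<rho> 0 / D ^ k \<le> \<rho> x"
  using weight_le[of 0 x k] D_power_pos[of k] by (simp add: field_simps)

lemma in_C0_mball:
  "v \<in> Metric_space.mball (C0_space \<rho>) (C0_dist \<rho>) u r \<longleftrightarrow>
     u \<in> C0_space \<rho> \<and> v \<in> C0_space \<rho> \<and> C0_dist \<rho> u v < r"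
  using Metric_space.in_mball[OF Metric_space_C0[OF admissible]] .

lemma openin_C0_mball: "openin (C0_topology \<rho>) (Metric_space.mball (C0_space \<rho>) (C0_dist \<rho>) u r)"
  unfolding C0_topology_def using Metric_space.openin_mball[OF Metric_space_C0[OF admissible]] .

lemma openin_C0_E:
  assumes "openin (C0_topology \<rho>) U" "u \<in> U"
  obtains r where "r > 0" "u \<in> C0_space \<rho>"
    "\<And>v. v \<in> C0_space \<rho> \<Longrightarrow> C0_dist \<rho> u v < r \<Longrightarrow> v \<in> U"
proof -
  have "U \<subseteq> C0_space \<rho>" "\<exists>r>0. Metric_space.mball (C0_space \<rho>) (C0_dist \<rho>) u r \<subseteq> U"
    using assms Metric_space.openin_mtopology[OF Metric_space_C0[OF admissible]]
    unfolding C0_topology_def by blast+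
  then obtain r where r: "r > 0" "Metric_space.mball (C0_space \<rho>) (C0_dist \<rho>) u r \<subseteq> U"
    and u: "u \<in> C0_space \<rho>" using assms(2) by blast
  have "v \<in> U" if "v \<in> C0_space \<rho>" "C0_dist \<rho> u v < r" for v
    using that u in_C0_mball r(2) by blast
  with r(1) u show ?thesis using that by blast
qed

text \<open>Strong continuity of the semigroup. For \<open>x \<le> R\<close>, uniform continuity of
  \<open>u\<close> and boundedness of the weight suffice; for \<open>x > R\<close>, both terms are
  at most \<open>e / 2\<close>, because \<open>\<rho> x \<le> D ^ k * \<rho> (x + s)\<close> for
  shifts \<open>s \<le> k\<close>.\<close>

lemma translation_continuous:
  assumes u: "u \<in> C0_space \<rho>" and t0: "t0 \<ge> 0" and e: "e > 0"
  obtains d where "d > 0"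
    "\<And>t x. t \<ge> 0 \<Longrightarrow> \<bar>t - t0\<bar> < d \<Longrightarrow> x \<ge> 0 \<Longrightarrow> \<bar>u (x + t) - u (x + t0)\<bar> * \<rho> x \<le> e"
proof -
  define k where "k = nat \<lceil>t0 + 1\<rceil>"
  have k: "t0 + 1 \<le> real k" unfolding k_def by (rule real_nat_ceiling_ge)
  have "e / (2 * D ^ k) > 0" using e D_power_pos[of k] by simp
  then obtain R where R: "\<And>x. real R \<le> x \<Longrightarrow> \<bar>u x\<bar> * \<rho> x < e / (2 * D ^ k)"
    using C0_space_eventually_small[OF u] weight_pos by metis
  define K where "K = D ^ R * \<rho> 0"
  have K: "K > 0" using D_power_pos weight_pos by (simp add: K_def)
  have "uniformly_continuous_on {0..real R + real k} u"
    using u by (intro compact_uniformly_continuous)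
      (auto simp: C0_space_def intro: continuous_on_subset)
  moreover have "e / K > 0" using e K by simp
  ultimately obtain d0 where d0: "d0 > 0"
    and uc: "\<And>x y. x \<in> {0..real R + real k} \<Longrightarrow> y \<in> {0..real R + real k} \<Longrightarrow> dist y x < d0 \<Longrightarrow>
        dist (u y) (u x) < e / K"
    unfolding uniformly_continuous_on_def by metis
  show ?thesis
  proof (rule that)
    show "min d0 1 > 0" using d0 by simp
    fix t x assume t: "t \<ge> 0" "\<bar>t - t0\<bar> < min d0 1" and x: "(x::real) \<ge> 0"
    show "\<bar>u (x + t) - u (x + t0)\<bar> * \<rho> x \<le> e"
    proof (cases "x \<le> real R")
      case True
      have "t \<le> real k" "t0 \<le> real k" using t k by linarith+
      then have "\<bar>u (x + t) - u (x + t0)\<bar> \<le> e / K"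
        using uc[of "x + t0" "x + t"] t t0 x True k by (auto simp: dist_real_def)
      then have "\<bar>u (x + t) - u (x + t0)\<bar> * \<rho> x \<le> e / K * K"
        using weight_le_0[OF x True] weight_pos[OF x] e K by (intro mult_mono) (auto simp: K_def)
      then show ?thesis using K by simp
    next
      case False
      have far: "\<bar>u (x + s)\<bar> * \<rho> x \<le> e / 2" if s: "0 \<le> s" "s \<le> real k" for s
      proof -
        have "\<bar>u (x + s)\<bar> * \<rho> x \<le> \<bar>u (x + s)\<bar> * (D ^ k * \<rho> (x + s))"
          using weight_le[of x "x + s" k] x s by (intro mult_left_mono) auto
        also have "\<dots> = D ^ k * (\<bar>u (x + s)\<bar> * \<rho> (x + s))" by simp
        also have "\<dots> \<le> D ^ k * (e / (2 * D ^ k))"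
          using R[of "x + s"] False s D_power_pos[of k] by (intro mult_left_mono) auto
        finally show ?thesis using D_ge_1 by simp
      qed
      have "t \<le> real k" "t0 \<le> real k" using t k by linarith+
      moreover have "\<bar>u (x + t) - u (x + t0)\<bar> * \<rho> x \<le> (\<bar>u (x + t)\<bar> + \<bar>u (x + t0)\<bar>) * \<rho> x"
        using weight_pos[OF x] by (intro mult_right_mono) auto
      ultimately show ?thesis using far[of t] far[of t0] t t0 by (simp add: distrib_right)
    qed
  qed
qed

text \<open>By strong continuity the set of return times is relatively open in the half-line, hence
  Borel.\<close>

lemma return_times_measurable:
  assumes U: "openin (C0_topology \<rho>) U" and f: "f \<in> C0_space \<rho>"
  shows "{t. 0 \<le> t \<and> translation t f \<in> U} \<in> sets lebesgue" (is "?S \<in> _")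
proof -
  have "openin (top_of_set {0..}) ?S"
    unfolding openin_euclidean_subtopology_iff
  proof (intro conjI ballI)
    fix t0 assume "t0 \<in> ?S"
    then have t0: "t0 \<ge> 0" "translation t0 f \<in> U" by auto
    obtain r where r: "r > 0" "\<And>v. v \<in> C0_space \<rho> \<Longrightarrow> C0_dist \<rho> (translation t0 f) v < r \<Longrightarrow> v \<in> U"
      using openin_C0_E[OF U t0(2)] by metis
    obtain d where d: "d > 0" "\<And>t x. t \<ge> 0 \<Longrightarrow> \<bar>t - t0\<bar> < d \<Longrightarrow> x \<ge> 0 \<Longrightarrow>
        \<bar>f (x + t) - f (x + t0)\<bar> * \<rho> x \<le> r / 2"
      using translation_continuous[OF f t0(1), of "r / 2"] r(1) by auto
    have "t \<in> ?S" if t: "t \<in> {0..}" "dist t t0 < d" for t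
    proof -
      have in_space: "translation t f \<in> C0_space \<rho>" "translation t0 f \<in> C0_space \<rho>"
        using translation_in_C0_space[OF admissible _ f] t t0 by auto
      have "C0_dist \<rho> (translation t0 f) (translation t f) \<le> r / 2"
      proof (rule C0_dist_le[OF in_space(2,1)])
        fix x :: real assume "0 \<le> x"
        then show "\<bar>translation t0 f x - translation t f x\<bar> * \<rho> x \<le> r / 2"
          using d(2)[of t x] t by (simp add: translation_def dist_real_def abs_minus_commute)
      qed
      then show ?thesis using r in_space t by auto
    qed
    then show "\<exists>e>0. \<forall>t\<in>{0..}. dist t t0 < e \<longrightarrow> t \<in> ?S" using d(1) by blast
  qed auto
  then obtain T where "open T" "?S = {0..} \<inter> T" by (auto simp: openin_open)
  then have "?S \<in> sets borel" by simp
  then show ?thesis by (simp add: sets_completionI_sets)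
qed

end
section \<open>Necessity\<close>

definition plateau :: "real \<Rightarrow> nat \<Rightarrow> real \<Rightarrow> real" where
  "plateau a L x = a * max 0 (min 1 (real L - x))"

lemma plateau_inner: "x + 1 \<le> real L \<Longrightarrow> plateau a L x = a"
  by (simp add: plateau_def)

lemma plateau_outer: "real L \<le> x \<Longrightarrow> plateau a L x = 0"
  by (simp add: plateau_def)

lemma plateau_in_C0_space: "restrict (plateau a L) {0..} \<in> C0_space \<rho>"
proof -
  have "continuous_on {0..} (plateau a L)"
    unfolding plateau_def by (intro continuous_intros)
  then have "continuous_on {0..} (restrict (plateau a L) {0..})"
    by (subst continuous_on_cong[OF refl, of _ _ "plateau a L"]) auto
  moreover have "((\<lambda>x. restrict (plateau a L) {0..} x * \<rho> x) \<longlongrightarrow> 0) at_top"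
  proof (rule tendsto_eventually)
    show "\<forall>\<^sub>F x in at_top. restrict (plateau a L) {0..} x * \<rho> x = 0"
      using eventually_ge_at_top[of "real L"] by eventually_elim (simp add: plateau_outer)
  qed
  ultimately show ?thesis by (simp add: C0_space_def)
qed

text \<open>\<open>M\<close> is arbitrary here, as the universal form of the equivalence demands;
  the heights \<open>A p\<close> and the tolerances \<open>e p\<close> adapt to it.\<close>

lemma (in tempered_weight) fhc_sets_exist:
  assumes fhc: "frequently_hypercyclic (C0_topology \<rho>) translation"
    and M: "positive_tending_to_infinity M"
  shows "\<exists>E. fhc_sets \<rho> M E"
proof -
  obtain f where f: "f \<in> C0_space \<rho>"
    and dens: "\<And>U. openin (C0_topology \<rho>) U \<Longrightarrow> U \<noteq> {} \<Longrightarrow>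
      lower_Dens {t. 0 \<le> t \<and> translation t f \<in> U} > 0"
    using fhc topspace_C0_topology[OF admissible] unfolding frequently_hypercyclic_def by blast
  have Mpos: "M p > 0" if "p \<ge> 1" for p using M that by (simp add: positive_tending_to_infinity_def)
  \<comment> \<open>Cumulative sums make each height exceed \<open>M p\<close> by at least 2 and
    also keep different heights at least 2 apart, more than two errors of \<open>1 / 2\<close> can
    bridge.\<close>
  define A where "A p = (\<Sum>i\<le>p. 2 + \<bar>M i\<bar>)" for p
  have A_ge: "A p \<ge> 2 + \<bar>M p\<bar>" for p
    using member_le_sum[of p "{..p}" "\<lambda>i. 2 + \<bar>M i\<bar>"] by (simp add: A_def)
  have A_less: "A p + 2 \<le> A q" if "p < q" for p q
  proof -
    have "(\<Sum>i\<in>insert q {..p}. 2 + \<bar>M i\<bar>) \<le> A q"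
      unfolding A_def using that by (intro sum_mono2) auto
    then have "A p + (2 + \<bar>M q\<bar>) \<le> A q" using that by (simp add: A_def)
    then show ?thesis by linarith
  qed
  have A_gap: "\<bar>A p - A q\<bar> \<ge> 2" if "p \<noteq> q" for p q
    using A_less[of p q] A_less[of q p] that by linarith
  \<comment> \<open>The first bound forces an error of at most \<open>1 / 2\<close> at arguments up
    to \<open>p + 5\<close>, where \<open>\<rho>\<close> is at least
    \<open>\<rho> 0 / D ^ (p + 5)\<close>. The second yields the factor \<open>1 / M p\<close> of
    (d), its \<open>D\<close> paying for a shift of less than one unit.\<close>
  define e where "e p = min (\<rho> 0 / (2 * D ^ (p + 5))) (1 / (D * M p))" for p
  have e_pos: "e p > 0" if "p \<ge> 1" for p
    using weight_pos[of 0] D_power_pos[of "p + 5"] D_ge_1 Mpos[OF that] by (simp add: e_def)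
  \<comment> \<open>The plateau is flat up to \<open>p + 3\<close>. After a shift of less than 1 it
    is still flat up to \<open>p + 2\<close>, and it vanishes from \<open>p + 4\<close> on.\<close>
  define g where "g p = plateau (A p) (p + 4)" for p
  define S where "S p = {t. 0 \<le> t \<and> translation t f \<in>
    Metric_space.mball (C0_space \<rho>) (C0_dist \<rho>) (restrict (g p) {0..}) (e p)}" for p

  \<comment> \<open>Integer return times and the values of \<open>f\<close> after them\<close>
  define H where "H p = {n. 1 \<le> n \<and> (\<exists>t\<in>S p. real n - 1 < t \<and> t \<le> real n)}" for p
  have H_dens: "lower_dens (H p) > 0" if "p \<ge> 1" for p
  proof -
    let ?u = "restrict (g p) {0..}"
    have u: "?u \<in> C0_space \<rho>" unfolding g_def by (rule plateau_in_C0_space)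
    then have "?u \<in> Metric_space.mball (C0_space \<rho>) (C0_dist \<rho>) ?u (e p)"
      using e_pos[OF that] Metric_space.zero[OF Metric_space_C0[OF admissible] u u]
      by (simp add: in_C0_mball)
    then have "lower_Dens (S p) > 0" unfolding S_def by (intro dens openin_C0_mball) auto
    then show ?thesis unfolding H_def by (rule lower_dens_ceiling_pos)
  qed
  \<comment> \<open>Rounding a return time \<open>t\<close> up to the integer \<open>n\<close> moves
    the argument of the plateau by \<open>s = n - t\<close>.\<close>
  have H_shift: "\<exists>s. 0 \<le> s \<and> s < 1 \<and> (\<forall>x\<ge>0. \<bar>f (real n + x) - g p (x + s)\<bar> * \<rho> (x + s) \<le> e p)"
    if n: "n \<in> H p" for n p
  proof -
    obtain t where t: "t \<in> S p" "real n - 1 < t" "t \<le> real n" using n by (auto simp: H_def)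
    have "\<bar>f (real n + x) - g p (x + (real n - t))\<bar> * \<rho> (x + (real n - t)) \<le> e p"
      if x: "x \<ge> 0" for x
    proof -
      let ?y = "x + (real n - t)"
      have y: "?y \<ge> 0" using x t by simp
      have "\<bar>restrict (g p) {0..} ?y - translation t f ?y\<bar> * \<rho> ?y < e p"
        using le_C0_dist[OF admissible _ _ y] t(1) in_C0_mball unfolding S_def
        by (smt (verit) mem_Collect_eq)
      then show ?thesis using y by (simp add: translation_def abs_minus_commute add_ac)
    qed
    then show ?thesis using t by (intro exI[of _ "real n - t"]) auto
  qed
  have H_close: "\<bar>f (real n + x) - g p (x + s)\<bar> \<le> 1 / 2"
    if "0 \<le> s" "s < 1" "0 \<le> x" "x \<le> real p + 4"
      "\<bar>f (real n + x) - g p (x + s)\<bar> * \<rho> (x + s) \<le> e p" for n p x s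
  proof -
    have w: "\<rho> 0 / D ^ (p + 5) \<le> \<rho> (x + s)" using that by (intro weight_ge_0) auto
    have "\<bar>f (real n + x) - g p (x + s)\<bar> * (\<rho> 0 / D ^ (p + 5)) \<le> 1 / 2 * (\<rho> 0 / D ^ (p + 5))"
      using mult_left_mono[OF w, of "\<bar>f (real n + x) - g p (x + s)\<bar>"] that(5)
      by (simp add: e_def)
    moreover have "\<rho> 0 / D ^ (p + 5) > 0" using weight_pos[of 0] D_power_pos[of "p + 5"] by simp
    ultimately show ?thesis by (simp only: mult_le_cancel_right_pos)
  qed
  have near: "\<bar>f (real n + x) - A p\<bar> \<le> 1 / 2" if n: "n \<in> H p" "0 \<le> x" "x \<le> real p + 2" for n p x
  proof -
    obtain s where s: "0 \<le> s" "s < 1" "\<bar>f (real n + x) - g p (x + s)\<bar> * \<rho> (x + s) \<le> e p"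
      using H_shift[OF n(1)] n(2) by blast
    have "g p (x + s) = A p" unfolding g_def using s n by (intro plateau_inner) auto
    then show ?thesis using H_close[OF s(1,2) n(2) _ s(3)] n(3) by simp
  qed
  have end_small: "\<bar>f (real n + (real p + 4))\<bar> \<le> 1 / 2" if n: "n \<in> H p" for n p
  proof -
    let ?x = "real p + 4"
    obtain s where s: "0 \<le> s" "s < 1" "\<bar>f (real n + ?x) - g p (?x + s)\<bar> * \<rho> (?x + s) \<le> e p"
      using H_shift[OF n] by (metis add_nonneg_nonneg of_nat_0_le_iff zero_le_numeral)
    have "g p (?x + s) = 0" unfolding g_def using s by (intro plateau_outer) auto
    then show ?thesis using H_close[OF s(1,2) _ _ s(3)] by simp
  qed
  have far: "\<bar>f (real n + x)\<bar> * \<rho> x \<le> 1 / M p"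
    if n: "n \<in> H p" "real p + 4 \<le> x" "p \<ge> 1" for n p x
  proof -
    have x: "0 \<le> x" using n by linarith
    obtain s where s: "0 \<le> s" "s < 1" "\<bar>f (real n + x) - g p (x + s)\<bar> * \<rho> (x + s) \<le> e p"
      using H_shift[OF n(1)] x by blast
    have g0: "g p (x + s) = 0" unfolding g_def using s n by (intro plateau_outer) auto
    have "\<bar>f (real n + x)\<bar> * \<rho> x \<le> \<bar>f (real n + x)\<bar> * (D ^ 1 * \<rho> (x + s))"
      using s x by (intro mult_left_mono weight_le) auto
    also have "\<dots> = D * (\<bar>f (real n + x)\<bar> * \<rho> (x + s))" by simp
    also have "\<dots> \<le> D * (1 / (D * M p))"
      using s(3) g0 D_ge_1 by (intro mult_left_mono) (auto simp: e_def)
    also have "\<dots> = 1 / M p" using D_ge_1 by simp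
    finally show ?thesis .
  qed
  \<comment> \<open>If \<open>m\<close> falls on the ramp of the plateau started at \<open>n\<close>, then \<open>f\<close> is already small at \<open>m + 1\<close>,
    while the plateau started at \<open>m\<close> is still high there.\<close>
  have H_disjoint: "n + (p + 4) \<le> m" if n: "n \<in> H p" "m \<in> H q" "n \<le> m" "p \<noteq> q" for n m p q
  proof (rule ccontr)
    assume "\<not> n + (p + 4) \<le> m"
    then consider "m - n \<le> p + 2" | "m + 1 = n + (p + 4)" using n(3) by linarith
    then show False
    proof cases
      case 1
      have "\<bar>f (real m) - A p\<bar> \<le> 1 / 2" using near[OF n(1), of "real (m - n)"] 1 n(3) by simp
      moreover have "\<bar>f (real m) - A q\<bar> \<le> 1 / 2" using near[OF n(2), of 0] by simp
      ultimately show False using A_gap[OF n(4)] by linarith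
    next
      case 2
      then have "real m + 1 = real n + (real p + 4)" by (simp flip: of_nat_add of_nat_Suc)
      then have "\<bar>f (real m + 1)\<bar> \<le> 1 / 2" using end_small[OF n(1)] by (simp only:)
      moreover have "\<bar>f (real m + 1) - A q\<bar> \<le> 1 / 2" using near[OF n(2), of 1] by simp
      ultimately show False using A_ge[of q] by linarith
    qed
  qed

  \<comment> \<open>Thinning of the return times and verification of the four conditions\<close>
  have "\<exists>B. B \<subseteq> H p \<and> (p \<ge> 1 \<longrightarrow> lower_dens B > 0) \<and>
      (\<forall>n\<in>B. \<forall>m\<in>B. n < m \<longrightarrow> n + (p + 4) \<le> m)" for p
  proof (cases "p \<ge> 1")
    case True
    have "H p \<subseteq> {1..}" by (auto simp: H_def)
    then show ?thesis using separated_subset[OF _ H_dens[OF True], of "p + 4"] by (metis trans_le_add2 one_le_numeral)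
  \<comment> \<open>The index 0 carries no density requirement, so the empty set serves.\<close>
  qed (auto intro: exI[of _ "{}"])
  then obtain E where E_sub: "\<And>p. E p \<subseteq> H p" and E_dens: "\<And>p. p \<ge> 1 \<Longrightarrow> lower_dens (E p) > 0"
    and E_sep: "\<And>p n m. n \<in> E p \<Longrightarrow> m \<in> E p \<Longrightarrow> n < m \<Longrightarrow> n + (p + 4) \<le> m"
    by metis
  \<comment> \<open>Equal indices are separated by the thinning, distinct ones by
    \<open>H_disjoint\<close>.\<close>
  have gap: "n + (p + 4) \<le> m" if "n \<in> E p" "m \<in> E q" "n < m \<or> n \<le> m \<and> p \<noteq> q" for n m p q
  proof (cases "p = q")
    case True
    then show ?thesis using that E_sep by auto
  next
    case False
    have "n \<in> H p" "m \<in> H q" using that E_sub by blast+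
    then show ?thesis using H_disjoint[of n p m q] that(3) False by auto
  qed
  \<comment> \<open>The summand 1 gives (c), since \<open>\<rho>\<close> is then dominated by
    \<open>f * \<rho>\<close> in absolute value along \<open>E q\<close>; the summand
    \<open>\<bar>M q\<bar>\<close> gives the second factor in (d).\<close>
  have f_ge: "\<bar>f (real m)\<bar> \<ge> 1 + \<bar>M q\<bar>" if "m \<in> E q" for m q
    using near[of m q 0] A_ge[of q] that E_sub[of q] by (auto simp: abs_if split: if_splits)
  have "fhc_sets \<rho> M E"
    unfolding fhc_sets_def
  proof (intro conjI allI impI ballI)
    fix p :: nat
    show "E p \<subseteq> {1..}" using E_sub[of p] by (auto simp: H_def)
    show "lower_dens (E p) > 0" if "p \<ge> 1" using E_dens that .
    show "((\<lambda>n. \<rho> (real n)) \<longlongrightarrow> 0) (inf sequentially (principal (E p)))"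
    proof (rule Lim_null_comparison)
      have "\<rho> (real n) \<le> \<bar>f (real n) * \<rho> (real n)\<bar>" if "n \<in> E p" for n
        using f_ge[OF that] weight_pos[of "real n"] mult_right_mono[of 1 "\<bar>f (real n)\<bar>" "\<rho> (real n)"]
        by (simp add: abs_mult)
      then show "\<forall>\<^sub>F n in inf sequentially (principal (E p)).
          norm (\<rho> (real n)) \<le> \<bar>f (real n) * \<rho> (real n)\<bar>"
        using weight_pos by (simp add: eventually_inf_principal less_imp_le)
      have "((\<lambda>n. f (real n) * \<rho> (real n)) \<longlongrightarrow> 0) sequentially"
        using f filterlim_compose[OF _ filterlim_real_sequentially, of "\<lambda>x. f x * \<rho> x"]
        by (simp add: C0_space_def)
      then show "((\<lambda>n. \<bar>f (real n) * \<rho> (real n)\<bar>) \<longlongrightarrow> 0) (inf sequentially (principal (E p)))"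
        by (intro tendsto_rabs_zero) (rule tendsto_mono[OF inf_le1])
    qed
    fix q :: nat
    show "(E p + {0..p}) \<inter> (E q + {0..q}) = {}" if "p \<noteq> q"
    proof -
      have False if "n \<in> E p" "i \<le> p" "m \<in> E q" "j \<le> q" "n + i = m + j" for n i m j
        using gap[of n p m q] gap[of m q n p] that \<open>p \<noteq> q\<close> by (cases "n \<le> m") auto
      then show ?thesis by (auto simp: set_plus_def)
    qed
    fix n m assume pq: "p \<ge> 1" "q \<ge> 1" and nm: "n \<in> E p" "m \<in> E q" "n < m"
    have "real p + 4 \<le> real m - real n"
      using gap[OF nm(1,2)] nm(3) by (simp flip: of_nat_diff)
    then have "\<bar>f (real m)\<bar> * \<rho> (real m - real n) \<le> 1 / M p"
      using far[of n p "real m - real n"] nm E_sub pq by auto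
    moreover have "M q * \<rho> (real m - real n) \<le> \<bar>f (real m)\<bar> * \<rho> (real m - real n)"
      using f_ge[OF nm(2)] weight_pos[of "real m - real n"] nm(3) by (intro mult_right_mono) auto
    ultimately have "M q * \<rho> (real m - real n) \<le> 1 / M p" by linarith
    then show "\<rho> (real m - real n) \<le> 1 / (M p * M q)"
      using Mpos[OF pq(1)] Mpos[OF pq(2)] by (simp add: field_simps)
  qed
  then show ?thesis by blast
qed

section \<open>A countable dense family\<close>

definition hat :: "real \<Rightarrow> real" where
  "hat y = max 0 (1 - \<bar>y\<bar>)"

lemma hat_bounds: "0 \<le> hat y" "hat y \<le> 1"
  by (auto simp: hat_def)

lemma hat_eq_0: "1 \<le> \<bar>y\<bar> \<Longrightarrow> hat y = 0"
  by (simp add: hat_def)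

text \<open>Integer translates of \<open>hat\<close> form a partition of unity on the half-line. The
  trapezoid is the closed form of the finite sums on which the induction runs.\<close>

lemma sum_hat:
  assumes "0 \<le> y"
  shows "(\<Sum>j\<le>N. hat (y - real j)) = max 0 (min 1 (real N + 1 - y))"
proof (induction N)
  case 0
  then show ?case using assms by (auto simp: hat_def)
next
  case (Suc N)
  then show ?case by (simp add: hat_def)
qed

text \<open>Piecewise linear functions with rational values at the nodes \<open>j / (k + 1)\<close>,
  so that the parameters \<open>k\<close> and \<open>qs\<close> range over a countable set. The
  first tent already rises to the left of 0, within one unit.\<close>

definition tent_sum :: "nat \<Rightarrow> rat list \<Rightarrow> real \<Rightarrow> real" where
  "tent_sum k qs x = (\<Sum>j<length qs. of_rat (qs ! j) * hat (real (Suc k) * x - real j))"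

lemma continuous_tent_sum: "continuous_on UNIV (tent_sum k qs)"
  unfolding tent_sum_def hat_def by (intro continuous_intros)

lemma tent_sum_left: "x \<le> -1 \<Longrightarrow> tent_sum k qs x = 0"
  unfolding tent_sum_def
proof (intro sum.neutral ballI)
  fix j assume "x \<le> -1"
  then have "real (Suc k) * x \<le> 1 * (-1)"
    using mult_left_mono[of x "-1" "real (Suc k)"] by simp
  then have "1 \<le> \<bar>real (Suc k) * x - real j\<bar>" by linarith
  then show "of_rat (qs ! j) * hat (real (Suc k) * x - real j) = 0" by (simp only: hat_eq_0 mult_zero_right)
qed

lemma tent_sum_right: "real (length qs) \<le> x \<Longrightarrow> tent_sum k qs x = 0"
  unfolding tent_sum_def
proof (intro sum.neutral ballI)
  fix j assume x: "real (length qs) \<le> x" and j: "j \<in> {..<length qs}"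
  have "1 * x \<le> real (Suc k) * x" using x by (intro mult_right_mono) auto
  moreover have "real j + 1 \<le> real (length qs)" using j by simp
  ultimately have "1 \<le> \<bar>real (Suc k) * x - real j\<bar>" using x by linarith
  then show "of_rat (qs ! j) * hat (real (Suc k) * x - real j) = 0" by (simp only: hat_eq_0 mult_zero_right)
qed

lemma tent_sum_bound: "\<bar>tent_sum k qs x\<bar> \<le> (\<Sum>j<length qs. \<bar>of_rat (qs ! j)\<bar>)"
proof -
  have "\<bar>of_rat (qs ! j) * hat (real (Suc k) * x - real j)\<bar> \<le> \<bar>of_rat (qs ! j)\<bar>" for j
    using hat_bounds mult_left_mono[of "hat (real (Suc k) * x - real j)" 1 "\<bar>of_rat (qs ! j)\<bar>"]
    by (simp add: abs_mult)
  then show ?thesis unfolding tent_sum_def by (intro order_trans[OF sum_abs] sum_mono) auto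
qed

context tempered_weight
begin

text \<open>\<open>u\<close> is sampled at the nodes, up to rational rounding. By the partition of
  unity the error at \<open>x\<close> is an average of the errors at nodes closer than
  \<open>1 / c\<close>. Nodes below \<open>R + 1\<close> are handled by uniform continuity and the
  bound \<open>K\<close> of the weight on \<open>[0, R + 2]\<close>; the others have coefficient 0
  and force \<open>x \<ge> R\<close>, where \<open>u\<close> itself is small.\<close>

lemma tent_sum_dense:
  assumes u: "u \<in> C0_space \<rho>" and e: "e > 0"
  shows "\<exists>k qs. \<forall>x\<ge>0. \<bar>tent_sum k qs x - u x\<bar> * \<rho> x \<le> e"
proof -
  obtain R where R: "\<And>x. real R \<le> x \<Longrightarrow> \<bar>u x\<bar> * \<rho> x < e"
    using C0_space_eventually_small[OF u e] weight_pos by metis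
  define K where "K = D ^ (R + 2) * \<rho> 0"
  have K: "K > 0" unfolding K_def by (intro mult_pos_pos D_power_pos weight_pos) simp
  have eK: "e / K / 2 > 0" using e K by simp
  have "uniformly_continuous_on {0..real R + 2} u"
    using u by (intro compact_uniformly_continuous)
      (auto simp: C0_space_def intro: continuous_on_subset)
  then obtain d where d: "d > 0"
    and uc: "\<And>x y. x \<in> {0..real R + 2} \<Longrightarrow> y \<in> {0..real R + 2} \<Longrightarrow> dist y x < d \<Longrightarrow>
        dist (u y) (u x) < e / K / 2"
    using eK unfolding uniformly_continuous_on_def by metis
  obtain k where k: "inverse (real (Suc k)) < d" using reals_Archimedean[OF d] by blast
  define c where "c = real (Suc k)"
  have c: "c \<ge> 1" "1 / c < d" using k by (auto simp: c_def inverse_eq_divide)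
  define n where "n = Suc k * (R + 1)"
  have nc: "real n = c * (real R + 1)" by (simp add: n_def c_def algebra_simps)
  have "\<exists>q. \<bar>of_rat q - u (real j / c)\<bar> < e / K / 2" for j
  proof -
    obtain q where "u (real j / c) < of_rat q" "of_rat q < u (real j / c) + e / K / 2"
      using of_rat_dense[of "u (real j / c)" "u (real j / c) + e / K / 2"] eK by auto
    then show ?thesis by (intro exI[of _ q]) auto
  qed
  then obtain q where q: "\<And>j. \<bar>of_rat (q j) - u (real j / c)\<bar> < e / K / 2" by metis
  define Q where "Q j = (if j < n then real_of_rat (q j) else 0)" for j
  have "\<bar>tent_sum k (map q [0..<n]) x - u x\<bar> * \<rho> x \<le> e" if x: "x \<ge> 0" for x
  proof -
    have rx: "\<rho> x > 0" using x by (rule weight_pos)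
    have summand_le: "\<bar>Q j - u x\<bar> * \<rho> x * hat (c * x - real j) \<le> e * hat (c * x - real j)" for j
    proof (cases "1 \<le> \<bar>c * x - real j\<bar>")
      case True
      then show ?thesis by (simp add: hat_eq_0)
    next
      case False
      have "c * \<bar>x - real j / c\<bar> = \<bar>c * x - real j\<bar>"
        using c abs_mult[of c "x - real j / c"] by (simp add: right_diff_distrib)
      then have "c * \<bar>x - real j / c\<bar> < 1" using False by simp
      then have xj: "\<bar>x - real j / c\<bar> < 1 / c" using c by (simp add: field_simps)
      moreover have c1: "1 / c \<le> 1" using c by simp
      ultimately have xj1: "\<bar>x - real j / c\<bar> < 1" by linarith
      have "\<bar>Q j - u x\<bar> * \<rho> x \<le> e"
      proof (cases "j < n")
        case True
        then have "real j \<le> c * (real R + 1)" using nc by linarith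
        then have jR: "real j / c \<le> real R + 1" using c by (simp add: field_simps)
        have xR: "x \<le> real R + 2" using jR xj1 by linarith
        have "dist (u x) (u (real j / c)) < e / K / 2"
          using uc[of "real j / c" x] jR xR x c xj by (auto simp: dist_real_def)
        then have "\<bar>Q j - u x\<bar> \<le> e / K" using q[of j] True by (simp add: Q_def dist_real_def)
        moreover have "\<rho> x \<le> K" using weight_le_0[of x "R + 2"] x xR by (simp add: K_def)
        ultimately have "\<bar>Q j - u x\<bar> * \<rho> x \<le> e / K * K" using rx e K by (intro mult_mono) auto
        then show ?thesis using K by simp
      next
        case False
        then have "c * (real R + 1) \<le> real j" using nc by linarith
        then have "real R + 1 \<le> real j / c" using c by (simp add: field_simps)
        then have "real R \<le> x" using xj1 by linarith
        then show ?thesis using R[of x] False by (simp add: Q_def)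
      qed
      then show ?thesis using hat_bounds by (intro mult_right_mono)
    qed
    \<comment> \<open>Large enough to include all nonzero coefficients and to make the tents sum to
      1 at \<open>c * x\<close>.\<close>
    define N where "N = n + nat \<lceil>c * x\<rceil>"
    have "c * x \<le> real (nat \<lceil>c * x\<rceil>)" by (rule real_nat_ceiling_ge)
    then have N: "c * x \<le> real N" by (simp add: N_def)
    have one: "(\<Sum>j\<le>N. hat (c * x - real j)) = 1" using sum_hat[of "c * x" N] N x c by simp
    have "tent_sum k (map q [0..<n]) x = (\<Sum>j\<le>N. Q j * hat (c * x - real j))"
      unfolding tent_sum_def c_def[symmetric]
      by (intro sum.mono_neutral_cong_left) (auto simp: Q_def N_def)
    then have "tent_sum k (map q [0..<n]) x - u x
        = (\<Sum>j\<le>N. Q j * hat (c * x - real j)) - u x * (\<Sum>j\<le>N. hat (c * x - real j))"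
      using one by simp
    also have "\<dots> = (\<Sum>j\<le>N. (Q j - u x) * hat (c * x - real j))"
      by (simp add: sum_subtractf sum_distrib_left left_diff_distrib)
    finally have "\<bar>tent_sum k (map q [0..<n]) x - u x\<bar>
        \<le> (\<Sum>j\<le>N. \<bar>(Q j - u x) * hat (c * x - real j)\<bar>)" by simp
    then have "\<bar>tent_sum k (map q [0..<n]) x - u x\<bar> * \<rho> x
        \<le> (\<Sum>j\<le>N. \<bar>(Q j - u x) * hat (c * x - real j)\<bar>) * \<rho> x"
      using rx by (intro mult_right_mono) auto
    also have "\<dots> = (\<Sum>j\<le>N. \<bar>Q j - u x\<bar> * \<rho> x * hat (c * x - real j))"
      using hat_bounds by (auto simp: sum_distrib_right abs_mult intro!: sum.cong)
    also have "\<dots> \<le> (\<Sum>j\<le>N. e * hat (c * x - real j))" by (intro sum_mono summand_le)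
    also have "\<dots> = e" by (simp add: one flip: sum_distrib_left)
    finally show ?thesis .
  qed
  then show ?thesis by blast
qed

text \<open>Every member of the countable family occurs at infinitely many indices, because the second
  component of \<^const>\<open>prod_decode\<close> is ignored.\<close>

lemma dense_sequence:
  "\<exists>(h :: nat \<Rightarrow> real \<Rightarrow> real) (L :: nat \<Rightarrow> nat) (B :: nat \<Rightarrow> real).
    (\<forall>i. continuous_on UNIV (h i)) \<and> (\<forall>i. \<forall>x\<le>-1. h i x = 0) \<and> (\<forall>i. \<forall>x\<ge>real (L i). h i x = 0) \<and>
    (\<forall>i x. \<bar>h i x\<bar> \<le> B i) \<and>
    (\<forall>u\<in>C0_space \<rho>. \<forall>e>0. \<forall>N. \<exists>i\<ge>N. \<forall>x\<ge>0. \<bar>h i x - u x\<bar> * \<rho> x \<le> e)"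
proof -
  define a where "a i = (from_nat (fst (prod_decode i)) :: nat \<times> rat list)" for i
  have a: "\<exists>i\<ge>N. a i = y" for y N
    by (intro exI[of _ "prod_encode (to_nat y, N)"]) (simp add: a_def le_prod_encode_2)
  have dense: "\<exists>i\<ge>N. \<forall>x\<ge>0. \<bar>tent_sum (fst (a i)) (snd (a i)) x - u x\<bar> * \<rho> x \<le> e"
    if "u \<in> C0_space \<rho>" "e > 0" for u e N
  proof -
    obtain k qs where "\<forall>x\<ge>0. \<bar>tent_sum k qs x - u x\<bar> * \<rho> x \<le> e"
      using tent_sum_dense[OF \<open>u \<in> C0_space \<rho>\<close> \<open>e > 0\<close>] by blast
    moreover obtain i where "i \<ge> N" "a i = (k, qs)" using a by blast
    ultimately show ?thesis by (intro exI[of _ i]) auto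
  qed
  show ?thesis
    by (intro exI[of _ "\<lambda>i. tent_sum (fst (a i)) (snd (a i))"] exI[of _ "\<lambda>i. length (snd (a i))"]
        exI[of _ "\<lambda>i. \<Sum>j<length (snd (a i)). \<bar>of_rat (snd (a i) ! j)\<bar>"])
      (intro conjI allI ballI impI continuous_tent_sum tent_sum_left tent_sum_right tent_sum_bound dense)
qed

end

section \<open>Sufficiency\<close>

lemma (in tempered_weight) frequently_hypercyclic_of_fhc_sets:
  assumes M: "positive_tending_to_infinity M" and sets: "fhc_sets \<rho> M E"
  shows "frequently_hypercyclic (C0_topology \<rho>) translation"
proof -
  have E_dens: "\<And>p. p \<ge> 1 \<Longrightarrow> lower_dens (E p) > 0"
    and E_disjoint: "\<And>p q. p \<ge> 1 \<Longrightarrow> q \<ge> 1 \<Longrightarrow> p \<noteq> q \<Longrightarrow> (E p + {0..p}) \<inter> (E q + {0..q}) = {}"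
    and E_lim: "\<And>p. p \<ge> 1 \<Longrightarrow> ((\<lambda>n. \<rho> (real n)) \<longlongrightarrow> 0) (inf sequentially (principal (E p)))"
    and E_weight: "\<And>p q n m. p \<ge> 1 \<Longrightarrow> q \<ge> 1 \<Longrightarrow> n \<in> E p \<Longrightarrow> m \<in> E q \<Longrightarrow> n < m \<Longrightarrow>
        \<rho> (real m - real n) \<le> 1 / (M p * M q)"
    using sets unfolding fhc_sets_def by blast+
  obtain h :: "nat \<Rightarrow> real \<Rightarrow> real" and L :: "nat \<Rightarrow> nat" and B :: "nat \<Rightarrow> real"
    where "\<forall>i. continuous_on UNIV (h i)" "\<forall>i. \<forall>x\<le>-1. h i x = 0"
      "\<forall>i. \<forall>x\<ge>real (L i). h i x = 0" "\<forall>i x. \<bar>h i x\<bar> \<le> B i"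
      "\<forall>u\<in>C0_space \<rho>. \<forall>e>0. \<forall>N. \<exists>i\<ge>N. \<forall>x\<ge>0. \<bar>h i x - u x\<bar> * \<rho> x \<le> e"
    using dense_sequence by blast
  then have h_cont: "\<And>i. continuous_on UNIV (h i)"
    and h_left: "\<And>i x. x \<le> -1 \<Longrightarrow> h i x = 0"
    and h_right: "\<And>i x. real (L i) \<le> x \<Longrightarrow> h i x = 0"
    and h_bound: "\<And>i x. \<bar>h i x\<bar> \<le> B i"
    and h_dense: "\<And>u e N. u \<in> C0_space \<rho> \<Longrightarrow> e > 0 \<Longrightarrow> \<exists>i\<ge>N. \<forall>x\<ge>0. \<bar>h i x - u x\<bar> * \<rho> x \<le> e"
    by blast+

  \<comment> \<open>The indices \<open>p i\<close> and the starting points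
    \<open>F i\<close>\<close>
  have B: "B i \<ge> 0" for i using h_bound[of i 0] by linarith
  have r0: "\<rho> 0 > 0" by (rule weight_pos) simp
  \<comment> \<open>\<open>L i + 2\<close> lets a block fit into the window of (b). The bounds with
    \<open>B i\<close> and with \<open>i + 1\<close> make the influence of later blocks at most
    \<open>1 / (i + 1)\<close>. The last bound contradicts (d) for two close points of the same
    set.\<close>
  define P where "P i p \<longleftrightarrow> p \<ge> 1 \<and> p \<ge> L i + 2 \<and> M p \<ge> D ^ (L i + 1) * B i \<and> M p \<ge> real i + 1 \<and>
      M p \<ge> 1 + D ^ (L i + 2) / \<rho> 0" for i p
  have P_large: "\<exists>p\<ge>N. P i p" for N i
  proof -
    let ?Z = "max (D ^ (L i + 1) * B i) (max (real i + 1) (1 + D ^ (L i + 2) / \<rho> 0))"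
    have "\<forall>\<^sub>F p in sequentially. ?Z \<le> M p"
      using M by (simp only: positive_tending_to_infinity_def filterlim_at_top)
    then obtain p0 where "\<And>p. p \<ge> p0 \<Longrightarrow> ?Z \<le> M p" by (auto simp only: eventually_sequentially)
    then have "?Z \<le> M (N + p0 + L i + 2)" by simp
    then show ?thesis by (intro exI[of _ "N + p0 + L i + 2"]) (simp add: P_def)
  qed
  \<comment> \<open>A strictly increasing choice makes the indices distinct, so that (b) applies to
    any two of them.\<close>
  have "\<exists>p. \<forall>i. P i (p i) \<and> p i < p (Suc i)"
  proof (intro dependent_nat_choice)
    show "\<exists>p. P 0 p" using P_large by blast
    show "\<exists>q. P (Suc i) q \<and> p < q" for p i
      using P_large[of "Suc p" "Suc i"] by (auto simp: Suc_le_eq)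
  qed
  then obtain p where p: "\<And>i. P i (p i)" "\<And>i. p i < p (Suc i)" by blast
  have "strict_mono p" using p(2) by (simp add: strict_mono_Suc_iff)
  then have p_inj: "p i \<noteq> p j" if "i \<noteq> j" for i j using that by (simp add: strict_mono_eq)
  have p1: "p i \<ge> 1" and pL: "p i \<ge> L i + 2" and MB: "M (p i) \<ge> D ^ (L i + 1) * B i"
    and Mi: "M (p i) \<ge> real i + 1" and MD: "M (p i) \<ge> 1 + D ^ (L i + 2) / \<rho> 0" for i
    using p(1)[of i] by (auto simp: P_def)
  have Mpos: "M (p i) > 0" for i using Mi[of i] by linarith
  \<comment> \<open>By (c) only finitely many points are lost. The remaining blocks have weighted
    size at most \<open>1 / (i + 1)\<close>, which controls all large \<open>i\<close>
    simultaneously.\<close>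
  define F where "F i = {n \<in> E (p i). D ^ (L i + 1) * B i * \<rho> (real n) \<le> 1 / (real i + 1)}" for i
  have small_weight: "\<exists>n0. \<forall>n\<ge>n0. n \<in> E (p i) \<longrightarrow> D ^ (L i + 1) * B i * \<rho> (real n) < e"
    if "e > 0" for i e
  proof -
    have "((\<lambda>n. D ^ (L i + 1) * B i * \<rho> (real n)) \<longlongrightarrow> 0) (inf sequentially (principal (E (p i))))"
      using E_lim[OF p1] by (rule tendsto_mult_right_zero)
    from order_tendstoD(2)[OF this that] show ?thesis
      by (simp add: eventually_inf_principal eventually_sequentially)
  qed
  have F_dens: "lower_dens (F i) > 0" for i
  proof (rule lower_dens_cofinite_subset[OF E_dens[OF p1]])
    obtain n0 where n0: "\<And>n. n \<ge> n0 \<Longrightarrow> n \<in> E (p i) \<Longrightarrow>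
        D ^ (L i + 1) * B i * \<rho> (real n) < 1 / (real i + 1)"
      using small_weight[of "1 / (real i + 1)" i] by (auto simp: add_pos_nonneg)
    have "E (p i) - F i \<subseteq> {..<n0}"
      unfolding F_def using n0 by (force simp: not_le less_le)
    then show "finite (E (p i) - F i)" by (rule finite_subset) simp
  qed
  \<comment> \<open>For \<open>i = j\<close> this comes from (d): \<open>\<rho> (m - n)\<close> is too small for \<open>m - n\<close> to be small.\<close>
  have gap: "n + L i + 2 < m" if n: "n \<in> F i" "m \<in> F j" and nm: "n \<le> m" "(i, n) \<noteq> (j, m)" for i j n m
  proof (cases "i = j")
    case True
    then have "n < m" using nm by auto
    show ?thesis
    proof (rule ccontr)
      assume "\<not> n + L i + 2 < m"
      then have "\<rho> 0 \<le> D ^ (L i + 2) * \<rho> (real m - real n)"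
        using \<open>n < m\<close> by (intro weight_le) (auto simp: abs_if)
      also have "\<dots> \<le> D ^ (L i + 2) * (1 / (M (p i) * M (p i)))"
        using E_weight[OF p1 p1, of n i m i] n \<open>n < m\<close> True D_power_pos[of "L i + 2"]
        by (intro mult_left_mono) (auto simp: F_def less_imp_le)
      finally have "\<rho> 0 * (M (p i) * M (p i)) \<le> D ^ (L i + 2)"
        using Mpos[of i] by (simp add: field_simps)
      moreover have "M (p i) * 1 \<le> M (p i) * M (p i)"
        using Mi[of i] Mpos[of i] by (intro mult_left_mono) auto
      then have "\<rho> 0 * M (p i) \<le> \<rho> 0 * (M (p i) * M (p i))"
        using r0 by (intro mult_left_mono) auto
      moreover have "\<rho> 0 * (1 + D ^ (L i + 2) / \<rho> 0) \<le> \<rho> 0 * M (p i)"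
        using MD[of i] r0 by (intro mult_left_mono) auto
      moreover have "\<rho> 0 * (1 + D ^ (L i + 2) / \<rho> 0) = \<rho> 0 + D ^ (L i + 2)"
        using r0 by (simp add: field_simps)
      ultimately show False using r0 by linarith
    qed
  next
    case False
    show ?thesis
    proof (rule ccontr)
      assume "\<not> n + L i + 2 < m"
      then have "m - n \<le> p i" using pL[of i] by linarith
      then have "n + (m - n) \<in> E (p i) + {0..p i}" using n by (intro set_plus_intro) (auto simp: F_def)
      moreover have "m + 0 \<in> E (p j) + {0..p j}" using n by (intro set_plus_intro) (auto simp: F_def)
      ultimately show False using E_disjoint[OF p1 p1 p_inj[OF False]] nm by auto
    qed
  qed

  \<comment> \<open>The blocks and their sum\<close>
  define K where "K n y = (if \<exists>i. n \<in> F i then h (SOME i. n \<in> F i) (y - 1) else 0)" for n y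
  \<comment> \<open>By \<open>gap\<close> the sets \<open>F i\<close> are pairwise disjoint, so the
    choice of \<open>i\<close> is determined. The shift by 1 makes room for the part of
    \<open>h i\<close> to the left of 0, and the block starts after \<open>n\<close>.\<close>
  have K_eq: "K n y = h i (y - 1)" if n: "n \<in> F i" for n i y
  proof -
    have "j = i" if "n \<in> F j" for j using gap[of n j n i] that n by auto
    then have "(SOME i. n \<in> F i) = i" using n by (intro some_equality)
    moreover have "\<exists>i. n \<in> F i" using n by blast
    ultimately show ?thesis unfolding K_def by simp
  qed
  have K_zero: "K n y = 0" if "y \<le> 0" for n y
    using that by (simp add: K_def h_left)
  have K_nonzero: "\<exists>i. n \<in> F i \<and> 0 < y \<and> y < real (L i) + 1" if "K n y \<noteq> 0" for n y
  proof -
    obtain i where i: "n \<in> F i" using \<open>K n y \<noteq> 0\<close> by (auto simp: K_def split: if_splits)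
    moreover have "0 < y" using K_zero[of y n] \<open>K n y \<noteq> 0\<close> by linarith
    moreover have "y < real (L i) + 1" using h_right[of i "y - 1"] K_eq[OF i] \<open>K n y \<noteq> 0\<close> by force
    ultimately show ?thesis by blast
  qed
  have K_cont: "continuous_on UNIV (K n)" for n
  proof (cases "\<exists>i. n \<in> F i")
    case True
    then obtain i where "n \<in> F i" by blast
    then have "K n = (\<lambda>y. h i (y - 1))" using K_eq by auto
    then show ?thesis
      by (simp add: continuous_on_compose2[OF h_cont] continuous_on_diff)
  qed (simp add: K_def[abs_def])
  \<comment> \<open>A finite sum suffices at each \<open>x\<close>, because blocks with
    \<open>n \<ge> x\<close> vanish there.\<close>
  define f0 where "f0 x = (\<Sum>n\<le>nat \<lfloor>x\<rfloor>. K n (x - real n))" for x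
  have f0_eq: "f0 x = (\<Sum>n\<le>N. K n (x - real n))" if "x \<le> real N" for x N
    unfolding f0_def
  proof (rule sum.mono_neutral_left)
    show "{..nat \<lfloor>x\<rfloor>} \<subseteq> {..N}" using that by (auto simp: nat_le_iff floor_le_iff)
    show "\<forall>n\<in>{..N} - {..nat \<lfloor>x\<rfloor>}. K n (x - real n) = 0"
    proof
      fix n assume "n \<in> {..N} - {..nat \<lfloor>x\<rfloor>}"
      then have "\<lfloor>x\<rfloor> < int n" by auto
      then have "x - real n \<le> 0" by linarith
      then show "K n (x - real n) = 0" by (rule K_zero)
    qed
  qed simp
  have f0_block: "f0 x = h i (x - real n - 1)"
    if n: "n \<in> F i" and x: "real n \<le> x" "x \<le> real n + real (L i) + 1" for n i x
  proof -
    define N where "N = nat \<lceil>x\<rceil>"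
    have N: "x \<le> real N" unfolding N_def by (rule real_nat_ceiling_ge)
    have "K m (x - real m) = 0" if "m \<noteq> n" for m
    proof (rule ccontr)
      assume "K m (x - real m) \<noteq> 0"
      then obtain j where j: "m \<in> F j" "real m < x" "x < real m + real (L j) + 1"
        using K_nonzero by fastforce
      consider "n \<le> m" | "m \<le> n" by linarith
      then show False
      proof cases
        case 1
        then have "n + L i + 2 < m" using gap[OF n j(1)] that by auto
        then have "real n + real (L i) + 2 < real m" by linarith
        then show False using j x by linarith
      next
        case 2
        then have "m + L j + 2 < n" using gap[OF j(1) n] that by auto
        then have "real m + real (L j) + 2 < real n" by linarith
        then show False using j x by linarith
      qed
    qed
    then have "(\<Sum>m\<le>N. K m (x - real m)) = (\<Sum>m\<in>{n}. K m (x - real m))"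
      using N x by (intro sum.mono_neutral_right) auto
    then show ?thesis using f0_eq[OF N] K_eq[OF n] by simp
  qed
  have f0_cases: "f0 x = 0 \<or> (\<exists>n i. n \<in> F i \<and> real n \<le> x \<and> x \<le> real n + real (L i) + 1 \<and>
      f0 x = h i (x - real n - 1))" for x
  proof (cases "f0 x = 0")
    case False
    then obtain n where "K n (x - real n) \<noteq> 0" unfolding f0_def by (meson sum.not_neutral_contains_not_neutral)
    then obtain i where i: "n \<in> F i" "real n \<le> x" "x \<le> real n + real (L i) + 1"
      using K_nonzero by fastforce
    then show ?thesis using f0_block[OF i] by blast
  qed simp
  have f0_cont: "continuous_on UNIV f0"
  proof -
    have "continuous_on {..<real N} f0" for N
    proof (subst continuous_on_cong[OF refl])
      show "f0 x = (\<Sum>n\<le>N. K n (x - real n))" if "x \<in> {..<real N}" for x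
        using that by (intro f0_eq) auto
      show "continuous_on {..<real N} (\<lambda>x. \<Sum>n\<le>N. K n (x - real n))"
        by (intro continuous_on_sum continuous_on_compose2[OF K_cont] continuous_intros) auto
    qed
    then have "continuous_on (\<Union>N\<in>UNIV. {..<real N}) f0"
      by (intro continuous_on_open_UN) auto
    moreover have "(\<Union>N\<in>UNIV. {..<real N}) = (UNIV :: real set)"
      using reals_Archimedean2 by auto
    ultimately show ?thesis by simp
  qed
  have block_weight: "\<bar>f0 x\<bar> * \<rho> x \<le> D ^ (L i + 1) * B i * \<rho> (real n)"
    if "f0 x = h i y" "real n \<le> x" "x \<le> real n + real (L i) + 1" for x n i y
  proof -
    have "\<bar>f0 x\<bar> * \<rho> x \<le> B i * (D ^ (L i + 1) * \<rho> (real n))"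
      using that h_bound[of i y] B[of i] weight_le[of x "real n" "L i + 1"] weight_pos[of x]
      by (intro mult_mono) auto
    then show ?thesis by (simp add: mult_ac)
  qed

  \<comment> \<open>The sum as an element of the space\<close>
  define f where "f = restrict f0 {0..}"
  have f: "f \<in> C0_space \<rho>"
  proof -
    have "continuous_on {0..} f0" using f0_cont by (rule continuous_on_subset) simp
    then have "continuous_on {0..} f"
      unfolding f_def by (subst continuous_on_cong[OF refl, of _ _ f0]) auto
    moreover have "((\<lambda>x. f x * \<rho> x) \<longlongrightarrow> 0) at_top"
    proof (rule tendstoI)
      fix e :: real assume e: "e > 0"
      \<comment> \<open>Blocks with index above \<open>I\<close> are small by the definition of
        \<open>F\<close>. For each of the finitely many other indices, (c) makes the blocks small
        far out.\<close>
      obtain I where I: "inverse (real (Suc I)) < e" using reals_Archimedean[OF e] by blast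
      have "\<forall>\<^sub>F x in at_top. \<forall>n\<in>F i. x \<le> real n + real (L i) + 1 \<longrightarrow>
          D ^ (L i + 1) * B i * \<rho> (real n) < e" for i
      proof -
        obtain n0 where n0: "\<And>n. n \<ge> n0 \<Longrightarrow> n \<in> E (p i) \<Longrightarrow> D ^ (L i + 1) * B i * \<rho> (real n) < e"
          using small_weight[OF e] by blast
        show ?thesis
          using eventually_ge_at_top[of "real n0 + real (L i) + 1"]
        proof eventually_elim
          case (elim x)
          have "n0 \<le> n" if "x \<le> real n + real (L i) + 1" for n using that elim by linarith
          then show ?case using n0 by (simp add: F_def)
        qed
      qed
      then have "\<forall>\<^sub>F x in at_top. \<forall>i\<in>{..I}. \<forall>n\<in>F i. x \<le> real n + real (L i) + 1 \<longrightarrow>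
          D ^ (L i + 1) * B i * \<rho> (real n) < e"
        by (intro eventually_ball_finite) auto
      then show "\<forall>\<^sub>F x in at_top. dist (f x * \<rho> x) 0 < e"
        using eventually_ge_at_top[of 0]
      proof eventually_elim
        case (elim x)
        have "\<bar>f0 x\<bar> * \<rho> x < e"
        proof (cases "f0 x = 0")
          case True
          then show ?thesis using e by simp
        next
          case False
          then obtain n i where n: "n \<in> F i" "real n \<le> x" "x \<le> real n + real (L i) + 1"
              "f0 x = h i (x - real n - 1)" using f0_cases by blast
          have le: "\<bar>f0 x\<bar> * \<rho> x \<le> D ^ (L i + 1) * B i * \<rho> (real n)"
            using block_weight[OF n(4,2,3)] .
          show ?thesis
          proof (cases "i \<le> I")
            case True
            then show ?thesis using elim(1) n le by force
          next
            case False
            then have "1 / (real i + 1) \<le> inverse (real (Suc I))"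
              by (simp add: inverse_eq_divide frac_le)
            then show ?thesis using n(1) le I by (simp add: F_def)
          qed
        qed
        then show ?case using elim(2) weight_pos[of x] by (simp add: f_def abs_mult)
      qed
    qed
    ultimately show ?thesis by (simp add: C0_space_def f_def)
  qed
  \<comment> \<open>Up to \<open>L i\<close> there is no error. Beyond, a nonzero value comes from a
    later block at some \<open>m \<in> F j\<close>. There \<open>y\<close> differs from
    \<open>m - n\<close> by at most \<open>L j + 1\<close>, so (d) bounds the weight, and the choice
    of \<open>p j\<close> absorbs \<open>D ^ (L j + 1) * B j\<close>.\<close>
  have return: "\<bar>f0 (real n + 1 + y) - h i y\<bar> * \<rho> y \<le> 1 / (real i + 1)"
    if n: "n \<in> F i" and y: "0 \<le> y" for n i y
  proof (cases "y \<le> real (L i)")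
    case True
    then show ?thesis using f0_block[OF n, of "real n + 1 + y"] y by simp
  next
    case False
    then have h0: "h i y = 0" by (intro h_right) simp
    show ?thesis
    proof (cases "f0 (real n + 1 + y) = 0")
      case True
      then show ?thesis using h0 by simp
    next
      case nz: False
      then obtain m j where m: "m \<in> F j" "real m \<le> real n + 1 + y"
          "real n + 1 + y \<le> real m + real (L j) + 1"
          "f0 (real n + 1 + y) = h j (real n + 1 + y - real m - 1)" using f0_cases by blast
      have ne: "(i, n) \<noteq> (j, m)" using m(4) h0 nz by auto
      have "n < m"
      proof (rule ccontr)
        assume "\<not> n < m"
        then have "m + L j + 2 < n" using gap[OF m(1) n] ne by auto
        then have "real m + real (L j) + 2 < real n" by linarith
        then show False using m(3) y by linarith
      qed
      have "\<rho> y \<le> D ^ (L j + 1) * \<rho> (real m - real n)"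
        using \<open>n < m\<close> m y by (intro weight_le) (auto simp: abs_if)
      also have "\<dots> \<le> D ^ (L j + 1) * (1 / (M (p i) * M (p j)))"
        using E_weight[OF p1 p1, of n i m j] n m(1) \<open>n < m\<close> D_power_pos[of "L j + 1"]
        by (intro mult_left_mono) (auto simp: F_def less_imp_le)
      finally have "\<bar>f0 (real n + 1 + y) - h i y\<bar> * \<rho> y
          \<le> B j * (D ^ (L j + 1) * (1 / (M (p i) * M (p j))))"
        using h0 m(4) h_bound B weight_pos[OF y] by (intro mult_mono) auto
      also have "\<dots> = D ^ (L j + 1) * B j / M (p j) * (1 / M (p i))" by (simp add: mult_ac)
      also have "\<dots> \<le> 1 * (1 / (real i + 1))"
        using MB[of j] Mi[of i] Mpos B D_power_pos[of "L j + 1"]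
        by (intro mult_mono frac_le) (auto simp: divide_le_eq_1)
      finally show ?thesis by simp
    qed
  qed

  \<comment> \<open>Positive lower density of the return times\<close>
  show ?thesis
    unfolding frequently_hypercyclic_def
  proof (intro bexI[of _ f] allI impI)
    show "f \<in> topspace (C0_topology \<rho>)" using f topspace_C0_topology[OF admissible] by simp
    fix U assume U: "openin (C0_topology \<rho>) U \<and> U \<noteq> {}"
    then obtain u where "u \<in> U" by blast
    with U obtain r where r: "r > 0" and u: "u \<in> C0_space \<rho>"
      and U_ball: "\<And>v. v \<in> C0_space \<rho> \<Longrightarrow> C0_dist \<rho> u v < r \<Longrightarrow> v \<in> U"
      using openin_C0_E by metis
    obtain d where d: "d > 0"
      "\<And>s x. s \<ge> 0 \<Longrightarrow> \<bar>s - 0\<bar> < d \<Longrightarrow> x \<ge> 0 \<Longrightarrow> \<bar>u (x + s) - u (x + 0)\<bar> * \<rho> x \<le> r / 4"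
      using translation_continuous[OF u, of 0 "r / 4"] r by auto
    have D: "D > 0" using D_ge_1 by simp
    \<comment> \<open>Three errors of at most \<open>r / 4\<close> are added: shifting
      \<open>u\<close> by \<open>s\<close>, replacing \<open>u\<close> by \<open>h i\<close>, and
      the return error of \<open>h i\<close>. The last two are known at \<open>x + s\<close>, and
      passing to the weight at \<open>x\<close> costs \<open>D\<close>. The index \<open>i\<close>
      must be large as well as close to \<open>u\<close>, which is why every function recurs in the
      dense sequence.\<close>
    define N where "N = nat \<lceil>4 * D / r\<rceil>"
    have "4 * D / r \<le> real N" unfolding N_def by (rule real_nat_ceiling_ge)
    then have N: "4 * D \<le> r * real N" using r by (simp add: field_simps)
    have "r / (4 * D) > 0" using r D by simp
    then obtain i where i: "i \<ge> N" "\<And>x. x \<ge> 0 \<Longrightarrow> \<bar>h i x - u x\<bar> * \<rho> x \<le> r / (4 * D)"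
      using h_dense[OF u] by blast
    have "r * real N \<le> r * (real i + 1)" using i(1) r by (intro mult_left_mono) auto
    then have iD: "D * (1 / (real i + 1)) \<le> r / 4" using N by (simp add: field_simps)
    show "lower_Dens {t. 0 \<le> t \<and> translation t f \<in> U} > 0"
    proof (rule lower_Dens_pos_intervals[OF F_dens])
      show "0 < min (d / 2) (1 / 2)" "min (d / 2) (1 / 2) < 1" using d by auto
      show "{t. 0 \<le> t \<and> translation t f \<in> U} \<in> sets lebesgue"
        using U f by (intro return_times_measurable) auto
      fix n s assume n: "n \<in> F i" and s: "0 \<le> s" "s \<le> min (d / 2) (1 / 2)"
      let ?t = "real n + 1 + s"
      have v: "translation ?t f \<in> C0_space \<rho>"
        using s f by (intro translation_in_C0_space admissible) auto
      have "C0_dist \<rho> u (translation ?t f) \<le> r / 4 + r / 4 + r / 4"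
      proof (rule C0_dist_le[OF u v])
        fix x :: real assume x: "0 \<le> x"
        have "\<rho> x \<le> D ^ 1 * \<rho> (x + s)" using x s by (intro weight_le) auto
        then have shift: "\<bar>a\<bar> * \<rho> x \<le> D * (\<bar>a\<bar> * \<rho> (x + s))" for a
          using mult_left_mono[of "\<rho> x" "D * \<rho> (x + s)" "\<bar>a\<bar>"] by (simp add: mult_ac)
        have 1: "\<bar>u (x + s) - u x\<bar> * \<rho> x \<le> r / 4" using d(2)[of s x] s x d(1) by simp
        have "\<bar>h i (x + s) - u (x + s)\<bar> * \<rho> x \<le> D * (r / (4 * D))"
          using i(2)[of "x + s"] s x D by (intro order_trans[OF shift] mult_left_mono) auto
        then have 2: "\<bar>h i (x + s) - u (x + s)\<bar> * \<rho> x \<le> r / 4" using D by simp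
        have "\<bar>f0 (real n + 1 + (x + s)) - h i (x + s)\<bar> * \<rho> x \<le> D * (1 / (real i + 1))"
          using return[OF n, of "x + s"] s x D by (intro order_trans[OF shift] mult_left_mono) auto
        then have 3: "\<bar>f0 (real n + 1 + (x + s)) - h i (x + s)\<bar> * \<rho> x \<le> r / 4" using iD by linarith
        have "translation ?t f x = f0 (real n + 1 + (x + s))"
          using x s by (simp add: translation_def f_def add_ac)
        then have "\<bar>u x - translation ?t f x\<bar> \<le> \<bar>u (x + s) - u x\<bar> + \<bar>h i (x + s) - u (x + s)\<bar>
            + \<bar>f0 (real n + 1 + (x + s)) - h i (x + s)\<bar>" by simp
        then have "\<bar>u x - translation ?t f x\<bar> * \<rho> x \<le> (\<bar>u (x + s) - u x\<bar> + \<bar>h i (x + s) - u (x + s)\<bar>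
            + \<bar>f0 (real n + 1 + (x + s)) - h i (x + s)\<bar>) * \<rho> x"
          using weight_pos[OF x] by (intro mult_right_mono) auto
        then show "\<bar>u x - translation ?t f x\<bar> * \<rho> x \<le> r / 4 + r / 4 + r / 4"
          using 1 2 3 by (simp add: distrib_right)
      qed
      then show "?t \<in> {t. 0 \<le> t \<and> translation t f \<in> U}"
        using U_ball[OF v] r s by simp
    qed
  qed
qed

theorem theorem3p6:
  fixes \<rho> :: "real \<Rightarrow> real"
  assumes "admissible_weight \<rho>"
    and "bdd_above ((\<lambda>k::nat. \<rho> (real k + 1) / \<rho> (real k)) ` {1..})"
  shows "(frequently_hypercyclic (C0_topology \<rho>) translation \<longleftrightarrow>
            (\<exists>M E. positive_tending_to_infinity M \<and> fhc_sets \<rho> M E)) \<and>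
         (frequently_hypercyclic (C0_topology \<rho>) translation \<longleftrightarrow>
            (\<forall>M. positive_tending_to_infinity M \<longrightarrow> (\<exists>E. fhc_sets \<rho> M E)))"
proof -
  obtain D where "tempered_weight \<rho> D" using tempered_weight_exists[OF assms] .
  then interpret tempered_weight \<rho> D .
  \<comment> \<open>A concrete admissible sequence, needed to get from the universal form to the
    existential one.\<close>
  have "filterlim (\<lambda>n. real n) at_top sequentially" by (rule filterlim_real_sequentially)
  then have "positive_tending_to_infinity real" by (simp add: positive_tending_to_infinity_def)
  then show ?thesis using fhc_sets_exist frequently_hypercyclic_of_fhc_sets by metis
qed

end
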